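(* Let $\mathcal{A}_1$ and $\mathcal{A}_2$ be $C^*$-algebras, let $H$ be a Hilbert space, and let $\pi_1:\mathcal{A}_1\to\mathcal{L}(H)$ and $\pi_2:\mathcal{A}_2\to\mathcal{L}(H)$ be representations. Let $\Pi(\mathcal{A}_1,\mathcal{A}_2)\subset\mathcal{L}(H)$ be the $C^*$-algebra generated by $\pi_1(\mathcal{A}_1)$ and $\pi_2(\mathcal{A}_2)$. Suppose that: (1) $\mathcal{A}_1,\mathcal{A}_2$ are unital and $\mathcal{A}_2$ is abelian; (2) for all $a_1\in\mathcal{A}_1$ and $a_2\in\mathcal{A}_2$ the commutator $[\pi_1(a_1),\pi_2(a_2)]$ is compact; (3) for every $n\ge 1$ and all $x_k\in\mathcal{A}_1$, $y_k\in\mathcal{A}_2$, $1\leq k\leq n$, if $\sum_{k=1}^n\pi_1(x_k)\pi_2(y_k)\in\mathcal{K}(H)$, then $\sum_{k=1}^n x_k\otimes y_k=0$ in the algebraic tensor product $\mathcal{A}_1\otimes\mathcal{A}_2$. Then there exists a unique continuous $*$-homomorphism $\mathrm{sym}:\Pi(\mathcal{A}_1,\mathcal{A}_2)\to\mathcal{A}_1\otimes_{\min}\mathcal{A}_2$ such that $$\mathrm{sym}(\pi_1(x))=x\otimes 1,\qquad \mathrm{sym}(\pi_2(y))=1\otimes y,\qquad x\in\mathcal{A}_1,\ y\in\mathcal{A}_2.$$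
   Context: $\mathcal{L}(H)$ is the $*$-algebra of all bounded operators on the (complex) Hilbert space $H$ and $\mathcal{K}(H)$ is the ideal of compact operators. $\mathcal{A}_1\otimes_{\min}\mathcal{A}_2$ is the completion of the algebraic tensor product $\mathcal{A}_1\otimes\mathcal{A}_2$ in the minimal $C^*$-norm. Representations are $*$-representations. *)

theory Defs
  imports "HOL-Analysis.Analysis"
begin

section \<open>Complex vector spaces, C*-algebras and Hilbert spaces\<close>

class scaleC =
  fixes scaleC :: "complex \<Rightarrow> 'a \<Rightarrow> 'a" (infixr \<open>*\<^sub>C\<close> 75)

class complex_vector = real_vector + scaleC +
  assumes scaleC_add_right: "c *\<^sub>C (x + y) = c *\<^sub>C x + c *\<^sub>C y"
    and scaleC_add_left: "(c + d) *\<^sub>C x = c *\<^sub>C x + d *\<^sub>C x"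
    and scaleC_scaleC: "c *\<^sub>C d *\<^sub>C x = (c * d) *\<^sub>C x"
    and scaleR_scaleC: "r *\<^sub>R x = complex_of_real r *\<^sub>C x"

lemma scaleC_one: "1 *\<^sub>C x = (x::'a::complex_vector)"
  using scaleR_scaleC[of 1 x] by simp

lemma scaleC_zero_left: "0 *\<^sub>C x = (0::'a::complex_vector)"
  using scaleR_scaleC[of 0 x] by simp

lemma scaleC_zero_right: "c *\<^sub>C 0 = (0::'a::complex_vector)"
  using scaleC_add_right[of c 0 "0::'a"] by simp

lemma scaleC_minus_one: "(-1) *\<^sub>C x = - (x::'a::complex_vector)"
  using scaleR_scaleC[of "-1" x] by simp

lemma scaleC_minus_right: "c *\<^sub>C (- x) = - (c *\<^sub>C (x::'a::complex_vector))"
  by (metis mult.commute scaleC_minus_one scaleC_scaleC)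

lemma scaleC_diff_right: "c *\<^sub>C (x - y) = c *\<^sub>C x - c *\<^sub>C (y::'a::complex_vector)"
  by (metis scaleC_add_right scaleC_minus_right diff_conv_add_uminus)

class star_algebra = complex_vector + ring +
  fixes star :: "'a \<Rightarrow> 'a"
  assumes mult_scaleC_left: "(c *\<^sub>C x) * y = c *\<^sub>C (x * y)"
    and mult_scaleC_right: "x * (c *\<^sub>C y) = c *\<^sub>C (x * y)"
    and star_add: "star (x + y) = star x + star y"
    and star_scaleC: "star (c *\<^sub>C x) = cnj c *\<^sub>C star x"
    and star_mult: "star (x * y) = star y * star x"
    and star_star: "star (star x) = x"

class cstar_algebra = star_algebra + real_normed_algebra + banach +
  assumes norm_scaleC: "norm (c *\<^sub>C x) = cmod c * norm x"
    and cstar_identity: "norm (star x * x) = (norm x)\<^sup>2"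

text \<open>Neither here nor elsewhere is \<open>1 \<noteq> 0\<close> required: the zero algebra counts as unital.\<close>

class unital_cstar_algebra = cstar_algebra + monoid_mult

text \<open>The complex inner product is linear in its first argument. The real inner product and the
  norm are those of the underlying real space, so \<open>norm x = sqrt (Re (cinner x x))\<close>.\<close>

class chilbert_space = complex_vector + real_inner + banach +
  fixes cinner :: "'a \<Rightarrow> 'a \<Rightarrow> complex"
  assumes cinner_commute: "cinner x y = cnj (cinner y x)"
    and cinner_add_left: "cinner (x + y) z = cinner x z + cinner y z"
    and cinner_scaleC_left: "cinner (c *\<^sub>C x) y = c * cinner x y"
    and inner_eq_Re_cinner: "inner x y = Re (cinner x y)"

context chilbert_space
begin

lemma cinner_add_right: "cinner z (x + y) = cinner z x + cinner z y"
  by (metis cinner_add_left cinner_commute complex_cnj_add)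

lemma cinner_scaleC_right: "cinner x (c *\<^sub>C y) = cnj c * cinner x y"
  by (metis cinner_scaleC_left cinner_commute complex_cnj_mult)

lemma Im_cinner: "Im (cinner x y) = - inner (\<i> *\<^sub>C x) y"
  by (simp add: inner_eq_Re_cinner cinner_scaleC_left)

end

lemma cinner_eqI:
  fixes x y :: "'a::chilbert_space"
  assumes "\<And>z. cinner z x = cinner z y"
  shows "x = y"
proof -
  have "inner (x - y) x = inner (x - y) y"
    by (simp add: inner_eq_Re_cinner assms)
  then have "inner (x - y) (x - y) = 0"
    by (simp add: inner_diff_right)
  then show ?thesis by simp
qed

lemma norm_scaleC_chilbert: "norm (c *\<^sub>C x) = cmod c * norm (x::'a::chilbert_space)"
proof -
  have "cinner (c *\<^sub>C x) (c *\<^sub>C x) = complex_of_real ((cmod c)\<^sup>2) * cinner x x"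
    by (metis cinner_scaleC_left cinner_scaleC_right complex_norm_square mult.assoc)
  then have "inner (c *\<^sub>C x) (c *\<^sub>C x) = (cmod c)\<^sup>2 * inner x x"
    by (simp add: inner_eq_Re_cinner)
  then show ?thesis
    by (simp add: norm_eq_sqrt_inner real_sqrt_mult)
qed

section \<open>Bounded operators on a Hilbert space\<close>

typedef (overloaded) ('h::chilbert_space) bop =
  "{T :: 'h \<Rightarrow>\<^sub>L 'h. \<forall>c x. blinfun_apply T (c *\<^sub>C x) = c *\<^sub>C blinfun_apply T x}"
  morphisms bop_blinfun Bop
  by (rule exI[of _ 0]) (simp add: scaleC_zero_right)

setup_lifting type_definition_bop

lift_definition bop_apply :: "'h::chilbert_space bop \<Rightarrow> 'h \<Rightarrow> 'h" is blinfun_apply .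

lemma bop_eqI: "(\<And>x. bop_apply S x = bop_apply T x) \<Longrightarrow> S = T"
  by transfer (auto intro: blinfun_eqI)

lemma bop_apply_add: "bop_apply T (x + y) = bop_apply T x + bop_apply T y"
  by transfer (simp add: blinfun.add_right)

lemma bop_apply_scaleC: "bop_apply T (c *\<^sub>C x) = c *\<^sub>C bop_apply T x"
  by transfer simp

lemma bounded_linear_bop_apply: "bounded_linear (bop_apply T)"
  by transfer (rule blinfun.bounded_linear_right)

lemma bop_existence:
  fixes f :: "'h::chilbert_space \<Rightarrow> 'h"
  assumes "\<And>x y. f (x + y) = f x + f y" "\<And>c x. f (c *\<^sub>C x) = c *\<^sub>C f x"
    and "\<And>x. norm (f x) \<le> norm x * K"
  shows "\<exists>T. bop_apply T = f"
proof -
  have *: "bounded_linear f"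
    using assms by (intro bounded_linear_intro) (auto simp: scaleR_scaleC)
  then have "bop_apply (Bop (Blinfun f)) = f"
    using assms by (simp add: bop_apply.rep_eq Bop_inverse bounded_linear_Blinfun_apply)
  then show ?thesis by blast
qed

subsection \<open>Existence of the adjoint\<close>

lemma riesz_representation:
  fixes f :: "'h::{real_inner,banach} \<Rightarrow> real"
  assumes "bounded_linear f"
  shows "\<exists>v. \<forall>x. f x = inner v x"
proof -
  interpret f: bounded_linear f by fact
  obtain K where K: "\<And>x. norm (f x) \<le> norm x * K" "K \<ge> 0"
    using f.nonneg_bounded by auto
  define J where "J x = inner x x - 2 * f x" for x
  have lower: "J x \<ge> - K\<^sup>2" for x
  proof -
    have "f x \<le> norm x * K" using K(1)[of x] by simp
    moreover have "0 \<le> (norm x - K)\<^sup>2" by simp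
    ultimately show ?thesis
      unfolding J_def dot_square_norm power2_diff by linarith
  qed
  define m where "m = Inf (range J)"
  have bdd: "bdd_below (range J)" using lower by (auto intro!: bdd_belowI)
  have m_le: "m \<le> J x" for x unfolding m_def using bdd by (auto intro: cInf_lower)
  have "\<exists>x. J x < m + e" if "e > 0" for e
    using cInf_lessD[of "range J" "m + e"] that unfolding m_def by auto
  then have "\<forall>n. \<exists>x. J x < m + 1 / real (Suc n)" by simp
  then obtain X where X: "\<And>n. J (X n) < m + 1 / real (Suc n)" by metis
  have par: "(norm (x - y))\<^sup>2 = 2 * J x + 2 * J y - 4 * J ((1/2) *\<^sub>R (x + y))" for x y
    unfolding J_def power2_norm_eq_inner f.scaleR f.add
    by (simp add: inner_add_left inner_add_right inner_diff_left inner_diff_right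
        inner_commute algebra_simps)
  have close: "(norm (X i - X j))\<^sup>2 \<le> 2 / real (Suc i) + 2 / real (Suc j)" for i j
    using par[of "X i" "X j"] X[of i] X[of j] m_le[of "(1/2) *\<^sub>R (X i + X j)"] by simp
  have "Cauchy X"
  proof (rule CauchyI)
    fix e :: real assume e: "e > 0"
    obtain N where N: "4 / real (Suc N) < e\<^sup>2"
    proof -
      obtain N :: nat where "4 / e\<^sup>2 < real N" using reals_Archimedean2 by blast
      then have "4 / real (Suc N) < e\<^sup>2" using e
        by (simp add: field_simps) (smt (verit) zero_less_power)
      then show ?thesis using that by blast
    qed
    have "norm (X i - X j) < e" if "i \<ge> N" "j \<ge> N" for i j
    proof -
      have "2 / real (Suc i) \<le> 2 / real (Suc N)" "2 / real (Suc j) \<le> 2 / real (Suc N)"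
        using that by (auto intro!: divide_left_mono)
      then have "(norm (X i - X j))\<^sup>2 < e\<^sup>2" using close[of i j] N by simp
      then show ?thesis using e by (simp add: power_less_imp_less_base)
    qed
    then show "\<exists>M. \<forall>m\<ge>M. \<forall>n\<ge>M. norm (X m - X n) < e" by blast
  qed
  then obtain v where v: "X \<longlonglongrightarrow> v" using Cauchy_convergent convergent_def by blast
  have "(\<lambda>n. J (X n)) \<longlonglongrightarrow> J v"
    unfolding J_def by (intro tendsto_intros v f.tendsto)
  moreover have "(\<lambda>n. m + 1 / real (Suc n)) \<longlonglongrightarrow> m + 0"
    by (intro tendsto_intros LIMSEQ_Suc[OF lim_1_over_n])
  ultimately have "J v \<le> m + 0"
    by (rule LIMSEQ_le) (use X less_imp_le in blast)
  then have min: "J v \<le> J x" for x using m_le[of x] by simp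
  have "f x = inner v x" for x
  proof -
    define d where "d = inner v x - f x"
    have q: "0 \<le> 2 * t * d + t\<^sup>2 * inner x x" for t
    proof -
      have "J (v + t *\<^sub>R x) = J v + (2 * t * d + t\<^sup>2 * inner x x)"
        unfolding J_def f.add f.scaleR d_def
        by (simp add: inner_add_left inner_add_right inner_commute algebra_simps power2_eq_square)
      then show ?thesis using min[of "v + t *\<^sub>R x"] by simp
    qed
    define s where "s = inner x x + 1"
    have s: "s \<ge> 1" by (simp add: s_def)
    have "0 \<le> 2 * (- d / s) * d + (- d / s)\<^sup>2 * (s - 1)" using q[of "- d / s"] by (simp add: s_def)
    also have "\<dots> = - (d\<^sup>2 / s) - (d / s)\<^sup>2"
      using s by (simp add: field_simps power2_eq_square)
    finally have "d\<^sup>2 / s \<le> 0" by (smt (verit) zero_le_power2)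
    then have "d = 0" using s by (simp add: divide_le_0_iff)
    then show ?thesis by (simp add: d_def)
  qed
  then show ?thesis by blast
qed

lemma adjoint_exists:
  fixes T :: "'h::chilbert_space bop"
  shows "\<exists>S. (\<forall>x y. cinner (bop_apply S x) y = cinner x (bop_apply T y)) \<and>
    (\<forall>x. norm (bop_apply S x) \<le> norm x * norm (bop_blinfun T))"
proof -
  have "\<exists>v. \<forall>x. inner y (bop_apply T x) = inner v x" for y
    by (intro riesz_representation bounded_linear_intros bounded_linear_bop_apply
        bounded_linear_compose[OF bounded_linear_inner_right])
  then obtain f where f: "\<And>x y. inner y (bop_apply T x) = inner (f y) x" by metis
  have Im: "Im (cinner x y) = inner x (\<i> *\<^sub>C y)" for x y :: 'h
    by (simp add: inner_eq_Re_cinner cinner_scaleC_right)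
  have adj: "cinner (f y) x = cinner y (bop_apply T x)" for x y
    by (rule complex_eqI) (simp_all add: Im f[symmetric] bop_apply_scaleC flip: inner_eq_Re_cinner)
  have adj': "cinner x (f y) = cinner (bop_apply T x) y" for x y
    by (metis adj cinner_commute)
  have bound: "norm (f y) \<le> norm y * norm (bop_blinfun T)" for y
  proof -
    have "norm (f y) * norm (f y) = inner y (bop_apply T (f y))"
      by (simp add: f power2_norm_eq_inner flip: power2_eq_square)
    also have "\<dots> \<le> norm y * norm (bop_apply T (f y))" by (rule norm_cauchy_schwarz)
    also have "\<dots> \<le> norm y * (norm (bop_blinfun T) * norm (f y))"
      by (intro mult_left_mono) (simp_all add: bop_apply.rep_eq norm_blinfun)
    finally show ?thesis
      by (cases "f y = 0") (simp_all add: mult.assoc[symmetric])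
  qed
  have "\<exists>S. bop_apply S = f"
    by (rule bop_existence[OF _ _ bound]; rule cinner_eqI)
      (simp_all add: adj' cinner_add_right cinner_scaleC_right)
  then show ?thesis using adj bound by auto
qed

subsection \<open>The C*-algebra of bounded operators\<close>

instantiation bop :: (chilbert_space) real_normed_vector
begin

lift_definition zero_bop :: "'a bop" is 0 by (simp add: scaleC_zero_right)
lift_definition plus_bop :: "'a bop \<Rightarrow> 'a bop \<Rightarrow> 'a bop" is "(+)"
  by (simp add: blinfun.add_left scaleC_add_right)
lift_definition minus_bop :: "'a bop \<Rightarrow> 'a bop \<Rightarrow> 'a bop" is "(-)"
  by (simp add: blinfun.diff_left scaleC_diff_right)
lift_definition uminus_bop :: "'a bop \<Rightarrow> 'a bop" is "uminus"
  by (simp add: blinfun.minus_left scaleC_minus_right)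
lift_definition scaleR_bop :: "real \<Rightarrow> 'a bop \<Rightarrow> 'a bop" is "scaleR"
  by (simp add: blinfun.scaleR_left scaleR_scaleC scaleC_scaleC mult.commute)
lift_definition norm_bop :: "'a bop \<Rightarrow> real" is norm .

definition dist_bop :: "'a bop \<Rightarrow> 'a bop \<Rightarrow> real" where "dist_bop S T = norm (S - T)"
definition sgn_bop :: "'a bop \<Rightarrow> 'a bop" where "sgn_bop T = inverse (norm T) *\<^sub>R T"
definition uniformity_bop :: "('a bop \<times> 'a bop) filter" where
  "uniformity_bop = (INF e\<in>{0<..}. principal {(S, T). dist S T < e})"
definition open_bop :: "'a bop set \<Rightarrow> bool" where
  "open_bop U = (\<forall>T\<in>U. eventually (\<lambda>(T', S). T' = T \<longrightarrow> S \<in> U) uniformity)"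

instance
proof
  fix S T U :: "'a bop" and a b :: real
  show "S + T + U = S + (T + U)" "S + T = T + S" "0 + S = S" "- S + S = 0" "S - T = S + - T"
    by (transfer; simp)+
  show "a *\<^sub>R (S + T) = a *\<^sub>R S + a *\<^sub>R T" "(a + b) *\<^sub>R S = a *\<^sub>R S + b *\<^sub>R S"
    "a *\<^sub>R b *\<^sub>R S = (a * b) *\<^sub>R S" "1 *\<^sub>R S = S"
    by (transfer; simp add: scaleR_add_right scaleR_add_left)+
  show "norm S = 0 \<longleftrightarrow> S = 0" "norm (S + T) \<le> norm S + norm T" "norm (a *\<^sub>R S) = \<bar>a\<bar> * norm S"
    by (transfer; simp add: norm_triangle_ineq)+
qed (simp_all add: dist_bop_def sgn_bop_def uniformity_bop_def open_bop_def)

end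

lemma bop_apply_simps:
  "bop_apply 0 x = 0"
  "bop_apply (S + T) x = bop_apply S x + bop_apply T x"
  "bop_apply (S - T) x = bop_apply S x - bop_apply T x"
  "bop_apply (- T) x = - bop_apply T x"
  "bop_apply (r *\<^sub>R T) x = r *\<^sub>R bop_apply T x"
  by (transfer; simp add: blinfun.bilinear_simps)+

lemma norm_bop_apply: "norm (bop_apply T x) \<le> norm T * norm x"
  by transfer (rule norm_blinfun)

lemma norm_bop_bound:
  assumes "K \<ge> 0" "\<And>x. norm (bop_apply T x) \<le> K * norm x"
  shows "norm T \<le> K"
  using assms by transfer (rule norm_blinfun_bound)

lemma bounded_linear_scaleC_chilbert: "bounded_linear (\<lambda>x::'h::chilbert_space. c *\<^sub>C x)"
  by (rule bounded_linear_intro[where K = "cmod c"])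
    (simp_all add: scaleC_add_right scaleR_scaleC scaleC_scaleC norm_scaleC_chilbert mult.commute)

instance bop :: (chilbert_space) banach
proof
  fix X :: "nat \<Rightarrow> 'a bop"
  assume X: "Cauchy X"
  have nrm: "norm (bop_blinfun S - bop_blinfun T) = norm (S - T)" for S T :: "'a bop"
    by transfer simp
  have "Cauchy (\<lambda>n. bop_blinfun (X n))"
    using X by (simp add: Cauchy_iff nrm)
  then obtain L where L: "(\<lambda>n. bop_blinfun (X n)) \<longlonglongrightarrow> L"
    using Cauchy_convergent convergent_def by blast
  have lim: "(\<lambda>n. blinfun_apply (bop_blinfun (X n)) x) \<longlonglongrightarrow> blinfun_apply L x" for x
    by (intro tendsto_intros L)
  have "blinfun_apply L (c *\<^sub>C x) = c *\<^sub>C blinfun_apply L x" for c x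
  proof (rule LIMSEQ_unique[OF lim])
    have "(\<lambda>n. c *\<^sub>C blinfun_apply (bop_blinfun (X n)) x) \<longlonglongrightarrow> c *\<^sub>C blinfun_apply L x"
      by (rule bounded_linear.tendsto[OF bounded_linear_scaleC_chilbert lim])
    then show "(\<lambda>n. blinfun_apply (bop_blinfun (X n)) (c *\<^sub>C x)) \<longlonglongrightarrow> c *\<^sub>C blinfun_apply L x"
      using bop_blinfun[of "X _"] by auto
  qed
  then obtain T where T: "bop_blinfun T = L"
    using Bop_inverse by blast
  have "X \<longlonglongrightarrow> T"
    using L unfolding tendsto_iff dist_norm by (simp add: nrm flip: T)
  then show "convergent X" by (auto simp: convergent_def)
qed

instantiation bop :: (chilbert_space) cstar_algebra
begin

lift_definition scaleC_bop :: "complex \<Rightarrow> 'a bop \<Rightarrow> 'a bop"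
  is "\<lambda>c T. Blinfun (\<lambda>x. c *\<^sub>C blinfun_apply T x)"
  by (simp add: bounded_linear_Blinfun_apply bounded_linear_compose[OF bounded_linear_scaleC_chilbert]
      blinfun.bounded_linear_right scaleC_scaleC mult.commute)

lift_definition times_bop :: "'a bop \<Rightarrow> 'a bop \<Rightarrow> 'a bop" is "(o\<^sub>L)"
  by simp

definition star_bop :: "'a bop \<Rightarrow> 'a bop" where
  "star_bop T = (THE S. \<forall>x y. cinner (bop_apply S x) y = cinner x (bop_apply T y))"

lemma bop_apply_scaleC_left: "bop_apply (c *\<^sub>C T) x = c *\<^sub>C bop_apply T x" for T :: "'a bop"
  by transfer (simp add: bounded_linear_Blinfun_apply
      bounded_linear_compose[OF bounded_linear_scaleC_chilbert] blinfun.bounded_linear_right)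

lemma bop_apply_times: "bop_apply (S * T) x = bop_apply S (bop_apply T x)" for S T :: "'a bop"
  by transfer simp

lemma bop_adjoint_unique:
  fixes S S' T :: "'a bop"
  assumes "\<forall>x y. cinner (bop_apply S x) y = cinner x (bop_apply T y)"
    and "\<forall>x y. cinner (bop_apply S' x) y = cinner x (bop_apply T y)"
  shows "S = S'"
  by (rule bop_eqI, rule cinner_eqI) (metis assms cinner_commute)

lemma star_bop_eqI:
  fixes S T :: "'a bop"
  assumes "\<And>x y. cinner (bop_apply S x) y = cinner x (bop_apply T y)"
  shows "star T = S"
  unfolding star_bop_def using assms bop_adjoint_unique by (intro the_equality) blast+

lemma star_bop:
  fixes T :: "'a bop"
  shows cinner_star_left: "cinner (bop_apply (star T) x) y = cinner x (bop_apply T y)"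
    and cinner_star_right: "cinner x (bop_apply (star T) y) = cinner (bop_apply T x) y"
    and norm_star_bop_le: "norm (star T) \<le> norm T"
proof -
  obtain S where S: "\<forall>x y. cinner (bop_apply S x) y = cinner x (bop_apply T y)"
    "\<forall>x. norm (bop_apply S x) \<le> norm x * norm (bop_blinfun T)"
    using adjoint_exists[of T] by blast
  have eq: "star T = S" using S(1) by (intro star_bop_eqI) blast
  then show 1: "cinner (bop_apply (star T) x) y = cinner x (bop_apply T y)" for x y
    using S by blast
  show "cinner x (bop_apply (star T) y) = cinner (bop_apply T x) y"
    by (metis 1 cinner_commute)
  show "norm (star T) \<le> norm T"
    using S(2) by (intro norm_bop_bound) (simp_all add: eq norm_bop.rep_eq mult.commute)
qed

instance
proof
  fix S T U :: "'a bop" and c d :: complex and r :: real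
  note simps = bop_apply_scaleC_left bop_apply_times bop_apply_simps bop_apply_add bop_apply_scaleC
  show "c *\<^sub>C (S + T) = c *\<^sub>C S + c *\<^sub>C T" "(c + d) *\<^sub>C S = c *\<^sub>C S + d *\<^sub>C S"
    "c *\<^sub>C d *\<^sub>C S = (c * d) *\<^sub>C S" "r *\<^sub>R S = complex_of_real r *\<^sub>C S"
    by (rule bop_eqI; simp add: simps scaleC_add_right scaleC_add_left scaleC_scaleC scaleR_scaleC)+
  show "S * T * U = S * (T * U)" "(S + T) * U = S * U + T * U" "S * (T + U) = S * T + S * U"
    "(c *\<^sub>C S) * T = c *\<^sub>C (S * T)" "S * (c *\<^sub>C T) = c *\<^sub>C (S * T)"
    "(r *\<^sub>R S) * T = r *\<^sub>R (S * T)" "S * (r *\<^sub>R T) = r *\<^sub>R (S * T)"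
    by (rule bop_eqI; simp add: simps scaleR_scaleC)+
  show "star (S + T) = star S + star T"
    by (rule star_bop_eqI) (simp add: simps star_bop cinner_add_left cinner_add_right)
  show "star (c *\<^sub>C S) = cnj c *\<^sub>C star S"
    by (rule star_bop_eqI) (simp add: simps star_bop cinner_scaleC_left cinner_scaleC_right)
  show "star (S * T) = star T * star S"
    by (rule star_bop_eqI) (simp add: simps star_bop)
  show "star (star S) = S"
    by (rule star_bop_eqI) (simp add: star_bop)
  show "norm (c *\<^sub>C S) = cmod c * norm S"
  proof -
    have le: "norm (c *\<^sub>C S) \<le> cmod c * norm S" for c and S :: "'a bop"
      by (rule norm_bop_bound)
        (simp_all add: simps norm_scaleC_chilbert mult.assoc mult_left_mono norm_bop_apply)
    show ?thesis
    proof (cases "c = 0")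
      case True
      then show ?thesis using le[of 0 S] by simp
    next
      case False
      have "inverse c *\<^sub>C c *\<^sub>C S = S"
        using False by (intro bop_eqI) (simp add: simps scaleC_scaleC scaleC_one)
      then have "norm S \<le> inverse (cmod c) * norm (c *\<^sub>C S)"
        using le[of "inverse c" "c *\<^sub>C S"] by (simp add: norm_inverse)
      then have "cmod c * norm S \<le> norm (c *\<^sub>C S)"
        using False by (simp add: field_simps)
      then show ?thesis using le[of c S] by simp
    qed
  qed
  show mult: "norm (S * T) \<le> norm S * norm T" for S T :: "'a bop"
    by transfer (rule norm_blinfun_compose)
  show "norm (star S * S) = (norm S)\<^sup>2"
  proof (rule antisym)
    have "norm (star S * S) \<le> norm (star S) * norm S" by (rule mult)
    also have "\<dots> \<le> norm S * norm S" by (intro mult_right_mono norm_star_bop_le) simp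
    finally show "norm (star S * S) \<le> (norm S)\<^sup>2" by (simp add: power2_eq_square)
    have "norm (bop_apply S x) \<le> sqrt (norm (star S * S)) * norm x" for x
    proof -
      have "(norm (bop_apply S x))\<^sup>2 = inner (bop_apply (star S * S) x) x"
        by (simp add: power2_norm_eq_inner inner_eq_Re_cinner simps star_bop)
      also have "\<dots> \<le> norm (bop_apply (star S * S) x) * norm x" by (rule norm_cauchy_schwarz)
      also have "\<dots> \<le> norm (star S * S) * norm x * norm x"
        by (intro mult_right_mono norm_bop_apply) simp
      finally have "(norm (bop_apply S x))\<^sup>2 \<le> (sqrt (norm (star S * S)) * norm x)\<^sup>2"
        unfolding power_mult_distrib by (simp add: power2_eq_square mult.assoc)
      then show ?thesis by (rule power2_le_imp_le) simp
    qed
    then have "norm S \<le> sqrt (norm (star S * S))" by (intro norm_bop_bound) simp_all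
    then show "(norm S)\<^sup>2 \<le> norm (star S * S)" using power_mono[of "norm S" "sqrt (norm (star S * S))" 2] by simp
  qed
qed

end

definition compact_op :: "'h::chilbert_space bop \<Rightarrow> bool" where
  "compact_op T \<longleftrightarrow> compact (closure (bop_apply T ` cball 0 1))"

section \<open>Homomorphisms and generated C*-algebras\<close>

definition star_subalgebra :: "'a::star_algebra set \<Rightarrow> bool" where
  "star_subalgebra S \<longleftrightarrow> 0 \<in> S \<and> (\<forall>x\<in>S. \<forall>y\<in>S. x + y \<in> S \<and> x * y \<in> S) \<and>
    (\<forall>c. \<forall>x\<in>S. c *\<^sub>C x \<in> S) \<and> (\<forall>x\<in>S. star x \<in> S)"

definition cstar_generated :: "'a::cstar_algebra set \<Rightarrow> 'a set" where
  "cstar_generated G = (\<lambda>S. star_subalgebra S \<and> closed S) hull G"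

text \<open>Homomorphisms are not required to be unital.\<close>

definition star_hom_on :: "'a::star_algebra set \<Rightarrow> ('a \<Rightarrow> 'b::star_algebra) \<Rightarrow> bool" where
  "star_hom_on S f \<longleftrightarrow>
    (\<forall>x\<in>S. \<forall>y\<in>S. f (x + y) = f x + f y \<and> f (x * y) = f x * f y) \<and>
    (\<forall>c. \<forall>x\<in>S. f (c *\<^sub>C x) = c *\<^sub>C f x) \<and> (\<forall>x\<in>S. f (star x) = star (f x))"

abbreviation star_hom :: "('a::star_algebra \<Rightarrow> 'b::star_algebra) \<Rightarrow> bool" where
  "star_hom \<equiv> star_hom_on UNIV"

section \<open>The algebraic tensor product\<close>

text \<open>A list \<open>[(a\<^sub>1, b\<^sub>1), \<dots>, (a\<^sub>n, b\<^sub>n)]\<close> stands for the formal sum of the \<open>a\<^sub>k \<otimes> b\<^sub>k\<close>;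
  \<open>tensor_rel\<close> is the congruence generated by commutativity of the sum and the relations that make
  \<open>\<otimes>\<close> bilinear. Scalars and negatives need no separate generators, as \<open>c (a \<otimes> b) = (c a) \<otimes> b\<close>.\<close>

inductive tensor_rel ::
  "('a::complex_vector \<times> 'b::complex_vector) list \<Rightarrow> ('a \<times> 'b) list \<Rightarrow> bool" where
  refl: "tensor_rel xs xs"
| sym: "tensor_rel xs ys \<Longrightarrow> tensor_rel ys xs"
| trans: "tensor_rel xs ys \<Longrightarrow> tensor_rel ys zs \<Longrightarrow> tensor_rel xs zs"
| append: "tensor_rel xs xs' \<Longrightarrow> tensor_rel ys ys' \<Longrightarrow> tensor_rel (xs @ ys) (xs' @ ys')"
| comm: "tensor_rel (xs @ ys) (ys @ xs)"
| add_left: "tensor_rel [(a + a', b)] [(a, b), (a', b)]"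
| add_right: "tensor_rel [(a, b + b')] [(a, b), (a, b')]"
| scale: "tensor_rel [(c *\<^sub>C a, b)] [(a, c *\<^sub>C b)]"
| zero: "tensor_rel [(0, b)] []"

quotient_type (overloaded) ('a, 'b) tensor =
  "('a::complex_vector \<times> 'b::complex_vector) list" / tensor_rel
  by (rule equivpI) (auto intro!: reflpI sympI transpI intro: tensor_rel.intros)

lift_definition tensor :: "'a::complex_vector \<Rightarrow> 'b::complex_vector \<Rightarrow> ('a, 'b) tensor"
  (infixr \<open>\<otimes>\<close> 75) is "\<lambda>a b. [(a, b)]" .

declare tensor_rel.trans [trans]

lemma tensor_rel_swap: "tensor_rel (xs @ ys @ zs) (ys @ xs @ zs)"
  using tensor_rel.append[OF tensor_rel.comm[of xs ys] tensor_rel.refl[of zs]] by simp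

lemma tensor_rel_zero_right: "tensor_rel [(a, 0)] []"
proof -
  have "tensor_rel [(a, 0)] [(0, 0)]"
    using tensor_rel.scale[of 0 a 0, THEN tensor_rel.sym] by (simp add: scaleC_zero_left)
  then show ?thesis by (blast intro: tensor_rel.trans tensor_rel.zero)
qed

lemma tensor_rel_map:
  assumes "tensor_rel xs ys"
    and "\<And>a a' b. tensor_rel [f (a + a', b)] [f (a, b), f (a', b)]"
    and "\<And>a b b'. tensor_rel [f (a, b + b')] [f (a, b), f (a, b')]"
    and "\<And>c a b. tensor_rel [f (c *\<^sub>C a, b)] [f (a, c *\<^sub>C b)]"
    and "\<And>b. tensor_rel [f (0, b)] []"
  shows "tensor_rel (map f xs) (map f ys)"
  using assms(1)
  by (induction rule: tensor_rel.induct) (auto intro: tensor_rel.intros assms(2-))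

lemma tensor_rel_map_cong:
  assumes "\<And>y. tensor_rel [f y] [g y]"
  shows "tensor_rel (map f ys) (map g ys)"
proof (induction ys)
  case (Cons y ys)
  then show ?case using tensor_rel.append[OF assms[of y] Cons] by simp
qed (simp add: tensor_rel.refl)

lemma tensor_rel_map_split:
  assumes "\<And>y. tensor_rel [f y] [g y, h y]"
  shows "tensor_rel (map f ys) (map g ys @ map h ys)"
proof (induction ys)
  case (Cons y ys)
  have "tensor_rel (map f (y # ys)) ([g y] @ [h y] @ map g ys @ map h ys)"
    using tensor_rel.append[OF assms[of y] Cons] by simp
  also have "tensor_rel \<dots> ([g y] @ map g ys @ [h y] @ map h ys)"
    by (rule tensor_rel.append[OF tensor_rel.refl tensor_rel_swap])
  finally show ?case by simp
qed (simp add: tensor_rel.refl)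

lemma tensor_rel_map_Nil:
  assumes "\<And>y. tensor_rel [f y] []"
  shows "tensor_rel (map f ys) []"
proof (induction ys)
  case (Cons y ys)
  then show ?case using tensor_rel.append[OF assms[of y] Cons] by simp
qed (simp add: tensor_rel.refl)

lemma tensor_rel_cancel: "tensor_rel (map (\<lambda>(a, b). (- a, b)) xs @ xs) []"
proof (induction xs)
  case (Cons x xs)
  obtain a b where x: "x = (a, b)" by fastforce
  let ?f = "\<lambda>(a::'a, b::'b). (- a, b)"
  have "tensor_rel (map ?f (x # xs) @ x # xs) ([(- a, b)] @ [(a, b)] @ map ?f xs @ xs)"
    using tensor_rel.append[OF tensor_rel.refl tensor_rel_swap, of "[(- a, b)]" "map ?f xs" "[(a, b)]" xs]
    by (simp add: x)
  also have "tensor_rel \<dots> ([(- a, b), (a, b)] @ [])"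
    using tensor_rel.append[OF tensor_rel.refl Cons, of "[(- a, b), (a, b)]"] by simp
  also have "tensor_rel \<dots> [(0, b)]"
    using tensor_rel.add_left[of "- a" a b, THEN tensor_rel.sym] by simp
  also have "tensor_rel \<dots> []"
    by (rule tensor_rel.zero)
  finally show ?case .
qed (simp add: tensor_rel.refl)

instantiation tensor :: (complex_vector, complex_vector) complex_vector
begin

lift_definition zero_tensor :: "('a, 'b) tensor" is "[]" .

lift_definition plus_tensor :: "('a, 'b) tensor \<Rightarrow> ('a, 'b) tensor \<Rightarrow> ('a, 'b) tensor"
  is "(@)" by (rule tensor_rel.append)

lift_definition scaleC_tensor :: "complex \<Rightarrow> ('a, 'b) tensor \<Rightarrow> ('a, 'b) tensor"
  is "\<lambda>c. map (\<lambda>(a, b). (c *\<^sub>C a, b))"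
proof -
  have "tensor_rel [(c *\<^sub>C d *\<^sub>C a, b)] [(c *\<^sub>C a, d *\<^sub>C b)]" for c d and a :: 'a and b :: 'b
    using tensor_rel.scale[of d "c *\<^sub>C a" b] by (simp add: scaleC_scaleC mult.commute)
  then show "tensor_rel (map (\<lambda>(a, b). (c *\<^sub>C a, b)) xs) (map (\<lambda>(a, b). (c *\<^sub>C a, b)) ys)"
    if "tensor_rel xs ys" for c and xs ys :: "('a \<times> 'b) list"
    using that by (elim tensor_rel_map)
      (auto simp: scaleC_add_right scaleC_zero_right intro: tensor_rel.intros)
qed

definition scaleR_tensor :: "real \<Rightarrow> ('a, 'b) tensor \<Rightarrow> ('a, 'b) tensor" where
  "scaleR_tensor r t = complex_of_real r *\<^sub>C t"

definition uminus_tensor :: "('a, 'b) tensor \<Rightarrow> ('a, 'b) tensor" where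
  "uminus_tensor t = (-1) *\<^sub>C t"

definition minus_tensor :: "('a, 'b) tensor \<Rightarrow> ('a, 'b) tensor \<Rightarrow> ('a, 'b) tensor" where
  "minus_tensor s t = s + - t"

instance
proof
  fix s t u :: "('a, 'b) tensor" and c d :: complex and r q :: real
  show "s + t + u = s + (t + u)" by transfer (simp add: tensor_rel.refl)
  show "s + t = t + s" by transfer (rule tensor_rel.comm)
  show "0 + t = t" by transfer (simp add: tensor_rel.refl)
  show "- t + t = 0" unfolding uminus_tensor_def
    by transfer (simp add: scaleC_minus_one tensor_rel_cancel)
  show "s - t = s + - t" by (rule minus_tensor_def)
  show add_right: "c *\<^sub>C (s + t) = c *\<^sub>C s + c *\<^sub>C t" for c and s t :: "('a, 'b) tensor"
    by transfer (simp add: tensor_rel.refl)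
  show add_left: "(c + d) *\<^sub>C t = c *\<^sub>C t + d *\<^sub>C t" for c d and t :: "('a, 'b) tensor"
    by transfer (rule tensor_rel_map_split, auto simp: scaleC_add_left intro: tensor_rel.add_left)
  show scale: "c *\<^sub>C d *\<^sub>C t = (c * d) *\<^sub>C t" for c d and t :: "('a, 'b) tensor"
    by transfer (auto simp: scaleC_scaleC comp_def case_prod_unfold intro: tensor_rel.refl)
  show "r *\<^sub>R t = complex_of_real r *\<^sub>C t" by (rule scaleR_tensor_def)
  show "r *\<^sub>R (s + t) = r *\<^sub>R s + r *\<^sub>R t" "(r + q) *\<^sub>R t = r *\<^sub>R t + q *\<^sub>R t"
    "r *\<^sub>R q *\<^sub>R t = (r * q) *\<^sub>R t"
    by (simp_all add: scaleR_tensor_def add_right add_left scale)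
  show "1 *\<^sub>R t = t" unfolding scaleR_tensor_def
    by transfer (simp add: scaleC_one tensor_rel.refl)
qed

end

lemma tensor_add_left: "(a + a') \<otimes> b = a \<otimes> b + a' \<otimes> b"
  by transfer (simp add: tensor_rel.add_left)

lemma tensor_add_right: "a \<otimes> (b + b') = a \<otimes> b + a \<otimes> b'"
  by transfer (simp add: tensor_rel.add_right)

lemma tensor_scaleC_left: "(c *\<^sub>C a) \<otimes> b = c *\<^sub>C (a \<otimes> b)"
  by transfer (simp add: tensor_rel.refl)

lemma tensor_scaleC_right: "a \<otimes> (c *\<^sub>C b) = c *\<^sub>C (a \<otimes> b)"
  by transfer (simp add: tensor_rel.scale[THEN tensor_rel.sym])

lemma tensor_exhaust:
  obtains xs where "t = abs_tensor xs"
  by (induction t rule: tensor.abs_induct) blast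

lemma tensor_induct:
  assumes "P 0" "\<And>a b t. P t \<Longrightarrow> P (a \<otimes> b + t)"
  shows "P t"
proof -
  have "P (abs_tensor xs)" for xs
  proof (induction xs)
    case Nil
    then show ?case using assms(1) by (simp add: zero_tensor_def)
  next
    case (Cons x xs)
    obtain a b where x: "x = (a, b)" by fastforce
    have "abs_tensor (x # xs) = a \<otimes> b + abs_tensor xs"
      by (simp add: x tensor.abs_eq plus_tensor.abs_eq)
    then show ?case using assms(2)[OF Cons] by simp
  qed
  then show ?thesis by (cases t rule: tensor_exhaust) blast
qed

theorem tensor_universal_property:
  fixes f :: "'a::complex_vector \<Rightarrow> 'b::complex_vector \<Rightarrow> 'v::complex_vector"
  assumes add_left: "\<And>a a' b. f (a + a') b = f a b + f a' b"
    and add_right: "\<And>a b b'. f a (b + b') = f a b + f a b'"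
    and scale_left: "\<And>c a b. f (c *\<^sub>C a) b = c *\<^sub>C f a b"
    and scale_right: "\<And>c a b. f a (c *\<^sub>C b) = c *\<^sub>C f a b"
  shows "\<exists>!F. (\<forall>s t. F (s + t) = F s + F t) \<and> (\<forall>c t. F (c *\<^sub>C t) = c *\<^sub>C F t) \<and>
    (\<forall>a b. F (a \<otimes> b) = f a b)"
proof -
  define E where "E xs = sum_list (map (\<lambda>(a, b). f a b) xs)" for xs
  have f0: "f 0 b = 0" for b
    using add_left[of 0 0 b] by simp
  have E: "E xs = E ys" if "tensor_rel xs ys" for xs ys
    using that by (induction rule: tensor_rel.induct)
      (auto simp: E_def assms f0 add.commute)
  define F where "F t = E (rep_tensor t)" for t
  have F: "F (abs_tensor xs) = E xs" for xs
    unfolding F_def by (intro E) (metis Quotient3_rep_abs Quotient3_tensor tensor_rel.refl)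
  have Fadd: "F (s + t) = F s + F t" for s t
    by (cases s rule: tensor_exhaust, cases t rule: tensor_exhaust)
      (simp add: plus_tensor.abs_eq F E_def)
  have FscaleC: "F (c *\<^sub>C t) = c *\<^sub>C F t" for c t
  proof -
    have "E (map (\<lambda>(a, b). (c *\<^sub>C a, b)) xs) = c *\<^sub>C E xs" for xs
      by (induction xs) (auto simp: E_def scale_left scaleC_add_right scaleC_zero_right)
    then show ?thesis
      by (cases t rule: tensor_exhaust) (simp add: scaleC_tensor.abs_eq F)
  qed
  have Ften: "F (a \<otimes> b) = f a b" for a b
    by (simp add: tensor.abs_eq F E_def)
  show ?thesis
  proof (rule ex1I[of _ F])
    fix G :: "('a, 'b) tensor \<Rightarrow> 'v"
    assume G: "(\<forall>s t. G (s + t) = G s + G t) \<and> (\<forall>c t. G (c *\<^sub>C t) = c *\<^sub>C G t) \<and>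
      (\<forall>a b. G (a \<otimes> b) = f a b)"
    have G0: "H 0 = 0" if "\<And>s t. H (s + t) = H s + H t" for H :: "('a, 'b) tensor \<Rightarrow> 'v"
      using that[of 0 0] by simp
    have "G t = F t" for t
      by (induction t rule: tensor_induct) (use G G0[of G] G0[of F] Fadd Ften in simp_all)
    then show "G = F" by blast
  qed (simp add: Fadd FscaleC Ften)
qed

subsection \<open>The *-algebra structure\<close>

instantiation tensor :: (star_algebra, star_algebra) star_algebra
begin

lift_definition times_tensor :: "('a, 'b) tensor \<Rightarrow> ('a, 'b) tensor \<Rightarrow> ('a, 'b) tensor"
  is "\<lambda>xs ys. concat (map (\<lambda>(a, b). map (\<lambda>(c, d). (a * c, b * d)) ys) xs)"
proof -
  let ?m = "\<lambda>ys (a::'a, b::'b). map (\<lambda>(c, d). (a * c, b * d)) ys"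
  fix xs xs' ys ys' :: "('a \<times> 'b) list"
  assume xs: "tensor_rel xs xs'" and ys: "tensor_rel ys ys'"
  have m: "tensor_rel (?m ys x) (?m ys' x)" for x
    using ys by (cases x, simp, elim tensor_rel_map)
      (auto simp: distrib_left mult_scaleC_right intro: tensor_rel.intros)
  have "tensor_rel (concat (map (?m ys) xs)) (concat (map (?m ys') xs))"
  proof (induction xs)
    case (Cons x xs)
    then show ?case using tensor_rel.append[OF m[of x] Cons] by simp
  qed (simp add: tensor_rel.refl)
  moreover have "tensor_rel (concat (map (?m ys') xs)) (concat (map (?m ys') xs'))"
    using xs
  proof (induction rule: tensor_rel.induct)
    case (add_left a a' b)
    have "tensor_rel (?m ys' (a + a', b)) (?m ys' (a, b) @ ?m ys' (a', b))"
      unfolding prod.case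
      by (rule tensor_rel_map_split) (auto simp: distrib_right intro: tensor_rel.add_left)
    then show ?case by simp
  next
    case (add_right a b b')
    have "tensor_rel (?m ys' (a, b + b')) (?m ys' (a, b) @ ?m ys' (a, b'))"
      unfolding prod.case
      by (rule tensor_rel_map_split) (auto simp: distrib_right intro: tensor_rel.add_right)
    then show ?case by simp
  next
    case (scale c a b)
    show ?case
      by (simp, rule tensor_rel_map_cong) (auto simp: mult_scaleC_left intro: tensor_rel.scale)
  next
    case (zero b)
    show ?case
      by (simp, rule tensor_rel_map_Nil) (auto intro: tensor_rel.zero)
  qed (auto intro: tensor_rel.intros)
  ultimately show "tensor_rel (concat (map (?m ys) xs)) (concat (map (?m ys') xs'))"
    by (rule tensor_rel.trans)
qed

lift_definition star_tensor :: "('a, 'b) tensor \<Rightarrow> ('a, 'b) tensor"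
  is "map (\<lambda>(a, b). (star a, star b))"
proof -
  have "star (0::'a) = 0" using star_add[of "0::'a" 0] by simp
  then show "tensor_rel (map (\<lambda>(a, b). (star a, star b)) xs) (map (\<lambda>(a, b). (star a, star b)) ys)"
    if "tensor_rel xs ys" for xs ys :: "('a \<times> 'b) list"
    using that by (elim tensor_rel_map) (auto simp: star_add star_scaleC intro: tensor_rel.intros)
qed

lemma tensor_mult: "(a \<otimes> b) * (c \<otimes> d) = (a * c) \<otimes> (b * d)" for a c :: 'a and b d :: 'b
  by transfer (simp add: tensor_rel.refl)

lemma tensor_star: "star (a \<otimes> b) = star a \<otimes> star b" for a :: 'a and b :: 'b
  by transfer (simp add: tensor_rel.refl)

instance
proof
  fix s t u :: "('a, 'b) tensor" and c :: complex
  have zl: "0 * t = 0" for t :: "('a, 'b) tensor"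
    by transfer (simp add: tensor_rel.refl)
  have "abs_tensor xs * 0 = 0" for xs :: "('a \<times> 'b) list"
    by (simp add: zero_tensor_def times_tensor.abs_eq case_prod_unfold)
      (induction xs, simp_all)
  then have zr: "t * 0 = 0" for t :: "('a, 'b) tensor"
    by (cases t rule: tensor_exhaust) simp
  have z: "star (0 :: ('a, 'b) tensor) = 0"
    by transfer (simp add: tensor_rel.refl)
  show dl: "(s + t) * u = s * u + t * u" for s t u :: "('a, 'b) tensor"
    by transfer (simp add: tensor_rel.refl)
  have dr1: "(a \<otimes> b) * (t + u) = (a \<otimes> b) * t + (a \<otimes> b) * u" for a b and t u :: "('a, 'b) tensor"
    by transfer (simp add: tensor_rel.refl)
  show dr: "s * (t + u) = s * t + s * u" for s t u :: "('a, 'b) tensor"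
    by (induction s rule: tensor_induct) (simp_all add: zl dl dr1 algebra_simps)
  have as1: "(a \<otimes> b) * (c \<otimes> d) * u = (a \<otimes> b) * ((c \<otimes> d) * u)" for a b c d and u :: "('a, 'b) tensor"
    by (induction u rule: tensor_induct) (simp_all add: zr dr tensor_mult mult.assoc)
  have as2: "(a \<otimes> b) * t * u = (a \<otimes> b) * (t * u)" for a b and t u :: "('a, 'b) tensor"
    by (induction t rule: tensor_induct) (simp_all add: zl zr dl dr as1)
  show "s * t * u = s * (t * u)"
    by (induction s rule: tensor_induct) (simp_all add: zl dl as2)
  show sl: "(c *\<^sub>C s) * t = c *\<^sub>C (s * t)" for c and s t :: "('a, 'b) tensor"
  proof (induction s rule: tensor_induct)
    case (2 a b s)
    have "(c *\<^sub>C (a \<otimes> b)) * t = c *\<^sub>C ((a \<otimes> b) * t)"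
      by (induction t rule: tensor_induct)
        (simp_all add: zr dr scaleC_zero_right scaleC_add_right tensor_mult mult_scaleC_left
          flip: tensor_scaleC_left)
    then show ?case using 2 by (simp add: scaleC_add_right dl)
  qed (simp add: zl scaleC_zero_right)
  show "s * (c *\<^sub>C t) = c *\<^sub>C (s * t)"
  proof (induction s rule: tensor_induct)
    case (2 a b s)
    have "(a \<otimes> b) * (c *\<^sub>C (p \<otimes> q)) = c *\<^sub>C ((a \<otimes> b) * (p \<otimes> q))" for p q
      by (metis mult_scaleC_right tensor_mult tensor_scaleC_left)
    then have "(a \<otimes> b) * (c *\<^sub>C t) = c *\<^sub>C ((a \<otimes> b) * t)"
      by (induction t rule: tensor_induct)
        (simp_all add: zr dr scaleC_zero_right scaleC_add_right)
    then show ?case using 2 by (simp add: scaleC_add_right dl)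
  qed (simp add: zl scaleC_zero_right)
  show sa: "star (s + t) = star s + star t" for s t :: "('a, 'b) tensor"
    by transfer (simp add: tensor_rel.refl)
  show "star (c *\<^sub>C s) = cnj c *\<^sub>C star s"
    by transfer (auto simp: comp_def case_prod_unfold star_scaleC intro: tensor_rel.refl)
  show "star (star s) = s"
    by (induction s rule: tensor_induct) (simp_all add: z sa tensor_star star_star)
  have st1: "star ((a \<otimes> b) * t) = star t * star (a \<otimes> b)" for a b and t :: "('a, 'b) tensor"
    by (induction t rule: tensor_induct)
      (simp_all add: z zl zr sa dl dr tensor_star tensor_mult star_mult)
  show "star (s * t) = star t * star s"
    by (induction s rule: tensor_induct) (simp_all add: z zl zr sa dl dr st1)
qed

end

section \<open>The minimal C*-tensor product\<close>

definition cstar_norm :: "('a::star_algebra \<Rightarrow> real) \<Rightarrow> bool" where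
  "cstar_norm p \<longleftrightarrow>
    (\<forall>x. p x \<ge> 0) \<and> (\<forall>x. p x = 0 \<longleftrightarrow> x = 0) \<and>
    (\<forall>x y. p (x + y) \<le> p x + p y) \<and> (\<forall>c x. p (c *\<^sub>C x) = cmod c * p x) \<and>
    (\<forall>x y. p (x * y) \<le> p x * p y) \<and> (\<forall>x. p (star x * x) = (p x)\<^sup>2)"

definition minimal_cstar_norm :: "('a::star_algebra \<Rightarrow> real) \<Rightarrow> bool" where
  "minimal_cstar_norm p \<longleftrightarrow> cstar_norm p \<and> (\<forall>q. cstar_norm q \<longrightarrow> (\<forall>x. p x \<le> q x))"

text \<open>A completion of the algebraic tensor product in its minimal C*-norm is a C*-algebra together
  with an isometric *-homomorphism \<open>\<iota>\<close> of the algebraic tensor product onto a dense subalgebra. It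
  exists (Takesaki: the spatial norm is the least C*-norm) and is unique up to a unique isometric *-isomorphism
  compatible with the maps \<open>\<iota>\<close>, so it is described by this property rather than by a particular
  construction.\<close>

definition min_tensor_product ::
  "(('a::cstar_algebra, 'b::cstar_algebra) tensor \<Rightarrow> 'c::cstar_algebra) \<Rightarrow> bool" where
  "min_tensor_product \<iota> \<longleftrightarrow>
    star_hom \<iota> \<and> minimal_cstar_norm (\<lambda>t. norm (\<iota> t)) \<and> closure (range \<iota>) = UNIV"

end

theory Submission
  imports Defs
begin

text \<open>The symbol of an operator is read off modulo compact operators. By the compactness of the
  commutators, \<open>x \<otimes> y \<mapsto> \<pi>1 x * \<pi>2 y\<close> is a *-homomorphism of the algebraic tensor product modulo
  compact operators, and the last hypothesis says that it is injective there. Hence the norm of the Calkin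
  algebra, pulled back along it, is a C*-norm on the algebraic tensor product
  (\<open>cstar_norm_ess_norm_tensor_rep\<close>). The minimal C*-norm is below it, so the inverse map from
  classes of operators to \<open>\<iota>\<close>-images of tensors is contractive, extends to the closure, and is the
  symbol.

  The Calkin norm of \<open>T\<close> is taken in the form of the infimum, over the finite sets \<open>F\<close> of vectors,
  of the norm of \<open>T\<close> restricted to the orthogonal complement of \<open>F\<close>. The C*-identity then comes
  from the Cauchy-Schwarz inequality, and all that has to be known about compact operators is
  that they are exactly the operators of essential norm zero (\<open>ess_norm_compact_op\<close>,
  \<open>compact_op_of_ess_norm_0\<close>).

  As \<open>\<pi>1\<close> and \<open>\<pi>2\<close> may fail to be unital, \<open>\<pi>1 x\<close> itself need not be in the image of the tensor
  product, but \<open>\<pi>1 x * p\<close> is, modulo compact operators, for \<open>p = \<pi>1 1 * \<pi>2 1\<close>. Modulo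
  compact operators, \<open>p\<close> is a projection that commutes with both ranges, hence with \<open>P\<close>; so compression
  by \<open>p\<close> is multiplicative on \<open>P\<close>, and the symbol of \<open>T\<close> is defined through that of \<open>T * p\<close>. The
  operators that have a symbol form a closed *-subalgebra (\<open>closed_symbol_domain\<close>,
  \<open>star_subalgebra_symbol_domain\<close>) containing both ranges, and therefore \<open>P\<close>. Uniqueness holds
  because the elements of \<open>P\<close> at which two continuous *-homomorphisms agree again form a closed
  *-subalgebra.\<close>

section \<open>Algebras with involution\<close>

lemma star_zero: "star 0 = (0::'a::star_algebra)"
  using star_add[of "0::'a" 0] by simp

lemma star_diff: "star (x - y) = star x - star (y::'a::star_algebra)"
  using star_add[of "x - y" y] by simp

lemma star_one: "star 1 = (1::'x::unital_cstar_algebra)"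
  by (metis mult.right_neutral mult.left_neutral star_mult star_star)

lemma tendsto_star:
  assumes "(f \<longlongrightarrow> (c::'x::cstar_algebra)) F"
  shows "((\<lambda>n. star (f n)) \<longlongrightarrow> star c) F"
proof -
  have "norm (star x) \<le> norm x" for x :: 'x
  proof (cases "x = 0")
    case False
    have "norm (star x) * norm (star x) \<le> norm x * norm (star x)"
      using cstar_identity[of "star x"] norm_mult_ineq[of x "star x"]
      by (simp add: star_star power2_eq_square)
    then show ?thesis
      using norm_ge_zero[of "star x"] by (cases "star x = 0") auto
  qed (simp add: star_zero)
  then have "norm (star (f n) - star c) \<le> norm (f n - c)" for n
    by (metis star_diff)
  then have "((\<lambda>n. star (f n) - star c) \<longlongrightarrow> 0) F"
    by (intro Lim_null_comparison[OF always_eventually tendsto_norm_zero[OF LIM_zero[OF assms]]])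
      blast
  then show ?thesis by (rule LIM_zero_cancel)
qed

lemma star_hom_0: "star_hom f \<Longrightarrow> f 0 = 0"
  unfolding star_hom_on_def by (metis add_cancel_right_right UNIV_I)

lemma tensor_one_mult: "(1 \<otimes> 1) * t = t" "t * (1 \<otimes> 1) = t"
  for t :: "('a::unital_cstar_algebra, 'b::unital_cstar_algebra) tensor"
proof (induction t rule: tensor_induct)
  case 1
  have "(1 \<otimes> 1) * (0::('a, 'b) tensor) + (1 \<otimes> 1) * 0 = (1 \<otimes> 1) * 0"
    "(0::('a, 'b) tensor) * (1 \<otimes> 1) + 0 * (1 \<otimes> 1) = 0 * (1 \<otimes> 1)"
    using distrib_left[of "1 \<otimes> 1" "0::('a, 'b) tensor" 0]
      distrib_right[of "0::('a, 'b) tensor" 0 "1 \<otimes> 1"] by simp_all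
  then show "(1 \<otimes> 1) * (0::('a, 'b) tensor) = 0" "(0::('a, 'b) tensor) * (1 \<otimes> 1) = 0" by auto
next
  case (2 x y t)
  then show "(1 \<otimes> 1) * (x \<otimes> y + t) = x \<otimes> y + t" "(x \<otimes> y + t) * (1 \<otimes> 1) = x \<otimes> y + t"
    by (simp_all add: distrib_left distrib_right tensor_mult)
qed

section \<open>Complex inner products\<close>

lemma cinner_zero_left [simp]: "cinner 0 x = 0" for x :: "'h::chilbert_space"
  using cinner_add_left[of 0 0 x] by simp

lemma cinner_zero_right [simp]: "cinner x 0 = 0" for x :: "'h::chilbert_space"
  using cinner_add_right[of x 0 0] by simp

lemma cinner_diff_left: "cinner (x - y) z = cinner x z - cinner y z"
  for x y z :: "'h::chilbert_space"
  using cinner_add_left[of "x - y" y z] by simp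

lemma cinner_sum_left: "cinner (sum f A) z = (\<Sum>a\<in>A. cinner (f a) z)"
  for z :: "'h::chilbert_space"
  by (induction A rule: infinite_finite_induct) (simp_all add: cinner_add_left)

lemma cmod_cinner_le: "cmod (cinner x y) \<le> norm x * norm y" for x y :: "'h::chilbert_space"
proof (cases "cinner x y = 0")
  case False
  define u where "u = cnj (sgn (cinner x y))"
  have u: "cmod u = 1" using False by (simp add: u_def norm_sgn)
  have "u * cinner x y = complex_of_real (cmod (cinner x y))"
    unfolding u_def sgn_eq using False
    by (simp add: field_simps complex_norm_square[symmetric] power2_eq_square)
  then have "cmod (cinner x y) = inner (u *\<^sub>C x) y"
    by (simp add: inner_eq_Re_cinner cinner_scaleC_left)
  also have "\<dots> \<le> norm (u *\<^sub>C x) * norm y" by (rule norm_cauchy_schwarz)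
  finally show ?thesis by (simp add: norm_scaleC_chilbert u)
qed simp

definition orthonormal_set :: "'h::chilbert_space set \<Rightarrow> bool" where
  "orthonormal_set E \<longleftrightarrow> (\<forall>e\<in>E. \<forall>f\<in>E. cinner e f = (if e = f then 1 else 0))"

lemma orthonormal_set_norm: "orthonormal_set E \<Longrightarrow> e \<in> E \<Longrightarrow> norm e = 1"
  by (simp add: orthonormal_set_def norm_eq_sqrt_inner inner_eq_Re_cinner)

lemma cinner_orthonormal_residual:
  fixes x :: "'h::chilbert_space"
  assumes "finite E" "orthonormal_set E" "f \<in> E"
  shows "cinner (x - (\<Sum>e\<in>E. cinner x e *\<^sub>C e)) f = 0"
proof -
  have "(\<Sum>e\<in>E. cinner x e * cinner e f) = (\<Sum>e\<in>E. if e = f then cinner x e else 0)"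
    using assms by (intro sum.cong) (auto simp: orthonormal_set_def)
  then show ?thesis
    using assms by (simp add: cinner_diff_left cinner_sum_left cinner_scaleC_left sum.delta)
qed

lemma norm_orthonormal_residual_le:
  fixes x :: "'h::chilbert_space"
  assumes "finite E" "orthonormal_set E"
  shows "norm (x - (\<Sum>e\<in>E. cinner x e *\<^sub>C e)) \<le> norm x"
proof -
  define s where "s = (\<Sum>e\<in>E. cinner x e *\<^sub>C e)"
  define y where "y = x - s"
  have "inner s y = 0"
    unfolding s_def inner_sum_left
  proof (rule sum.neutral, rule ballI)
    fix e assume "e \<in> E"
    then have "cinner y e = 0"
      using cinner_orthonormal_residual[OF assms] by (simp add: y_def s_def)
    then have "cinner e y = 0" by (metis cinner_commute complex_cnj_zero)
    then show "inner (cinner x e *\<^sub>C e) y = 0"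
      by (simp add: inner_eq_Re_cinner cinner_scaleC_left)
  qed
  moreover have "x = y + s" by (simp add: y_def)
  ultimately have "(norm x)\<^sup>2 = (norm y)\<^sup>2 + (norm s)\<^sup>2"
    by (simp add: power2_norm_eq_inner inner_add_left inner_add_right inner_commute)
  then have "(norm y)\<^sup>2 \<le> (norm x)\<^sup>2" by simp
  then show ?thesis unfolding y_def s_def by (rule power2_le_imp_le) simp
qed

text \<open>Gram-Schmidt, in the only form needed: passing to an orthonormal set can only shrink the
  orthogonal complement.\<close>

lemma gram_schmidt_finite:
  fixes F :: "'h::chilbert_space set"
  assumes "finite F"
  shows "\<exists>E. finite E \<and> orthonormal_set E \<and>
    (\<forall>x. (\<forall>e\<in>E. cinner x e = 0) \<longrightarrow> (\<forall>f\<in>F. cinner x f = 0))"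
  using assms
proof (induction F)
  case empty
  then show ?case by (intro exI[of _ "{}"]) (simp add: orthonormal_set_def)
next
  case (insert f F)
  then obtain E where E: "finite E" "orthonormal_set E"
    "\<And>x f. \<forall>e\<in>E. cinner x e = 0 \<Longrightarrow> f \<in> F \<Longrightarrow> cinner x f = 0"
    by blast
  define s where "s = (\<Sum>e\<in>E. cinner f e *\<^sub>C e)"
  define g where "g = f - s"
  have g: "cinner g e = 0" if "e \<in> E" for e
    using cinner_orthonormal_residual[OF E(1,2) that] by (simp add: g_def s_def)
  have s: "cinner x s = 0" if "\<forall>e\<in>E. cinner x e = 0" for x
  proof -
    have "cinner s x = 0"
      unfolding s_def cinner_sum_left cinner_scaleC_left using that
      by (intro sum.neutral) (metis cinner_commute complex_cnj_zero mult_zero_right)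
    then show ?thesis by (metis cinner_commute complex_cnj_zero)
  qed
  have f: "f = g + s" by (simp add: g_def)
  show ?case
  proof (cases "g = 0")
    case True
    then have "f = s" using f by simp
    then show ?thesis using E s by (intro exI[of _ E]) auto
  next
    case False
    define h where "h = complex_of_real (1 / norm g) *\<^sub>C g"
    have hE: "cinner h e = 0" "cinner e h = 0" if "e \<in> E" for e
      using g[OF that] by (simp_all add: h_def cinner_scaleC_left cinner_scaleC_right)
        (metis cinner_commute complex_cnj_zero)
    have "cinner g g = complex_of_real ((norm g)\<^sup>2)"
      by (rule complex_eqI)
        (auto simp: power2_norm_eq_inner inner_eq_Re_cinner,
          metis cinner_commute complex_is_Real_iff Reals_cnj_iff)
    then have hh: "cinner h h = 1"
      using False by (simp add: h_def cinner_scaleC_left cinner_scaleC_right power2_eq_square)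
    have "cinner x f = 0" if x: "\<forall>e\<in>insert h E. cinner x e = 0" for x
    proof -
      have "cinner x g = 0"
        using x False by (simp add: h_def cinner_scaleC_right)
      then show ?thesis using s[of x] x by (simp add: f cinner_add_right)
    qed
    moreover have "h \<notin> E" using hE(1)[of h] hh by auto
    then have "orthonormal_set (insert h E)"
      using E(2) hE hh unfolding orthonormal_set_def by (metis insert_iff)
    ultimately show ?thesis
      using E(1,3) by (intro exI[of _ "insert h E"]) blast
  qed
qed

section \<open>The essential norm\<close>

definition bounded_off :: "'h::chilbert_space bop \<Rightarrow> 'h set \<Rightarrow> real \<Rightarrow> bool" where
  "bounded_off T F K \<longleftrightarrow> (\<forall>x. (\<forall>f\<in>F. cinner x f = 0) \<longrightarrow> norm (bop_apply T x) \<le> K * norm x)"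

text \<open>This is the norm of the class of \<open>T\<close> in the Calkin algebra: the infimum of the norms of the
  restrictions of \<open>T\<close> to closed subspaces of finite codimension. In this form the C*-identity
  is immediate, whereas for the distance to the compact operators it is usually derived from an
  approximate identity.\<close>

definition ess_norm :: "'h::chilbert_space bop \<Rightarrow> real" where
  "ess_norm T = Inf {K. K \<ge> 0 \<and> (\<exists>F. finite F \<and> bounded_off T F K)}"

lemma bounded_off_mono: "bounded_off T F K \<Longrightarrow> F \<subseteq> G \<Longrightarrow> K \<le> L \<Longrightarrow> bounded_off T G L"
  unfolding bounded_off_def
  by (meson mult_right_mono norm_ge_zero order_trans subsetD)

lemma ess_norm_le: "K \<ge> 0 \<Longrightarrow> finite F \<Longrightarrow> bounded_off T F K \<Longrightarrow> ess_norm T \<le> K"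
  unfolding ess_norm_def by (rule cInf_lower) (auto intro!: bdd_belowI)

lemma bounded_off_norm: "bounded_off T {} (norm T)"
  by (simp add: bounded_off_def norm_bop_apply)

lemma ess_norm_less:
  assumes "ess_norm T < K"
  obtains F where "finite F" "bounded_off T F K"
proof -
  let ?S = "{K. K \<ge> 0 \<and> (\<exists>F. finite F \<and> bounded_off T F K)}"
  have "?S \<noteq> {}" using bounded_off_norm[of T] norm_ge_zero[of T] by blast
  then obtain L where "L \<in> ?S" "L < K"
    using assms cInf_lessD[of ?S K] unfolding ess_norm_def by blast
  then show ?thesis using that bounded_off_mono[of T _ L _ K] by force
qed

lemma ess_norm_nonneg [simp]: "ess_norm T \<ge> 0"
  unfolding ess_norm_def
  using bounded_off_norm[of T] norm_ge_zero[of T] by (intro cInf_greatest) blast+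

lemma ess_norm_le_norm: "ess_norm T \<le> norm T"
  using ess_norm_le[OF _ _ bounded_off_norm] by simp

lemma ess_norm_le_0_iff [simp]: "ess_norm T \<le> 0 \<longleftrightarrow> ess_norm T = 0"
  using ess_norm_nonneg[of T] by linarith

lemma ess_norm_0 [simp]: "ess_norm 0 = 0"
  using ess_norm_le_norm[of 0] by simp

lemma ess_norm_add: "ess_norm (S + T) \<le> ess_norm S + ess_norm T"
proof (rule field_le_epsilon)
  fix e :: real assume "e > 0"
  obtain F where F: "finite F" "bounded_off S F (ess_norm S + e/2)"
    using ess_norm_less[of S "ess_norm S + e/2"] \<open>e > 0\<close> by auto
  obtain G where G: "finite G" "bounded_off T G (ess_norm T + e/2)"
    using ess_norm_less[of T "ess_norm T + e/2"] \<open>e > 0\<close> by auto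
  have "bounded_off (S + T) (F \<union> G) (ess_norm S + ess_norm T + e)"
    unfolding bounded_off_def bop_apply_simps
  proof (intro allI impI)
    fix x assume x: "\<forall>f\<in>F \<union> G. cinner x f = 0"
    have "norm (bop_apply S x + bop_apply T x) \<le> norm (bop_apply S x) + norm (bop_apply T x)"
      by (rule norm_triangle_ineq)
    also have "\<dots> \<le> (ess_norm S + e/2) * norm x + (ess_norm T + e/2) * norm x"
      using F(2) G(2) x unfolding bounded_off_def by (intro add_mono) auto
    finally show "norm (bop_apply S x + bop_apply T x) \<le> (ess_norm S + ess_norm T + e) * norm x"
      by (simp add: algebra_simps)
  qed
  then show "ess_norm (S + T) \<le> ess_norm S + ess_norm T + e"
    using F(1) G(1) \<open>e > 0\<close> by (intro ess_norm_le[of _ "F \<union> G"]) auto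
qed

text \<open>If \<open>x\<close> is orthogonal to the vectors \<open>star T g\<close>, then \<open>T x\<close> is orthogonal to the vectors \<open>g\<close>;
  so a bound for \<open>S\<close> away from \<open>G\<close> can be applied after \<open>T\<close>.\<close>

lemma bounded_off_mult:
  assumes "bounded_off S G K" "bounded_off T F L" "K \<ge> 0"
  shows "bounded_off (S * T) (F \<union> bop_apply (star T) ` G) (K * L)"
  unfolding bounded_off_def bop_apply_times
proof (intro allI impI)
  fix x assume x: "\<forall>f\<in>F \<union> bop_apply (star T) ` G. cinner x f = 0"
  have "\<forall>g\<in>G. cinner (bop_apply T x) g = 0"
    using x by (metis UnCI cinner_star_right imageI)
  then have "norm (bop_apply S (bop_apply T x)) \<le> K * norm (bop_apply T x)"
    using assms(1) unfolding bounded_off_def by blast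
  also have "\<dots> \<le> K * (L * norm x)"
    using assms(2,3) x unfolding bounded_off_def by (intro mult_left_mono) auto
  finally show "norm (bop_apply S (bop_apply T x)) \<le> K * L * norm x" by (simp add: mult.assoc)
qed

lemma ess_norm_mult: "ess_norm (S * T) \<le> ess_norm S * ess_norm T"
proof -
  have le: "ess_norm (S * T) \<le> (ess_norm S + 1 / real (Suc n)) * (ess_norm T + 1 / real (Suc n))"
    for n
  proof -
    let ?e = "1 / real (Suc n)"
    obtain G where G: "finite G" "bounded_off S G (ess_norm S + ?e)"
      using ess_norm_less[of S "ess_norm S + ?e"] by auto
    obtain F where F: "finite F" "bounded_off T F (ess_norm T + ?e)"
      using ess_norm_less[of T "ess_norm T + ?e"] by auto
    show ?thesis
      using F(1) G(1)
      by (intro ess_norm_le[OF _ _ bounded_off_mult[OF G(2) F(2)]]) auto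
  qed
  have "(\<lambda>n. (ess_norm S + 1 / real (Suc n)) * (ess_norm T + 1 / real (Suc n)))
      \<longlonglongrightarrow> (ess_norm S + 0) * (ess_norm T + 0)"
    by (intro tendsto_intros LIMSEQ_Suc[OF lim_1_over_n])
  then show ?thesis using le by (auto intro: LIMSEQ_le_const)
qed

lemma ess_norm_scaleC: "ess_norm (c *\<^sub>C T) = cmod c * ess_norm T"
proof -
  obtain I :: "'a bop" where I: "bop_apply I = (\<lambda>x. x)"
    using bop_existence[of "\<lambda>x. x" 1] by auto
  have le: "ess_norm (c *\<^sub>C T) \<le> cmod c * ess_norm T" for c and T :: "'a bop"
  proof -
    have "norm I \<le> 1" by (rule norm_bop_bound) (simp_all add: I)
    then have "norm (c *\<^sub>C I) \<le> cmod c" by (simp add: norm_scaleC mult_left_le)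
    then have "ess_norm (c *\<^sub>C I) \<le> cmod c" using ess_norm_le_norm order_trans by blast
    then have "ess_norm (c *\<^sub>C I) * ess_norm T \<le> cmod c * ess_norm T"
      by (intro mult_right_mono) simp_all
    moreover have "c *\<^sub>C T = (c *\<^sub>C I) * T"
      by (rule bop_eqI) (simp add: bop_apply_times bop_apply_scaleC_left I)
    ultimately show ?thesis using ess_norm_mult[of "c *\<^sub>C I" T] by simp
  qed
  show ?thesis
  proof (cases "c = 0")
    case False
    have "ess_norm T \<le> inverse (cmod c) * ess_norm (c *\<^sub>C T)"
      using le[of "inverse c" "c *\<^sub>C T"] False
      by (simp add: scaleC_scaleC scaleC_one norm_inverse)
    then show ?thesis using le[of c T] False by (simp add: field_simps)
  qed (simp add: scaleC_zero_left)
qed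

lemma ess_norm_minus [simp]: "ess_norm (- T) = ess_norm T"
  using ess_norm_scaleC[of "-1" T] by (simp add: scaleC_minus_one)

lemma ess_norm_minus_commute: "ess_norm (S - T) = ess_norm (T - S)"
  using ess_norm_minus[of "S - T"] by simp

lemma ess_norm_diff_triangle: "ess_norm (R - T) \<le> ess_norm (R - S) + ess_norm (S - T)"
  using ess_norm_add[of "R - S" "S - T"] by simp

text \<open>On the complement of \<open>F\<close>, \<open>norm (T x)\<^sup>2 = inner (star T (T x)) x \<le> K * norm x\<^sup>2\<close> whenever
  \<open>K\<close> bounds \<open>star T * T\<close> there.\<close>

lemma ess_norm_square_le: "(ess_norm T)\<^sup>2 \<le> ess_norm (star T * T)"
proof (rule field_le_epsilon)
  fix e :: real assume "e > 0"
  define K where "K = ess_norm (star T * T) + e"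
  have K: "K > 0" using \<open>e > 0\<close> by (simp add: K_def add_nonneg_pos)
  obtain F where F: "finite F" "bounded_off (star T * T) F K"
    using ess_norm_less[of "star T * T" K] \<open>e > 0\<close> by (auto simp: K_def)
  have "bounded_off T F (sqrt K)"
    unfolding bounded_off_def
  proof (intro allI impI)
    fix x assume x: "\<forall>f\<in>F. cinner x f = 0"
    have "(norm (bop_apply T x))\<^sup>2 = inner (bop_apply (star T * T) x) x"
      by (simp add: power2_norm_eq_inner inner_eq_Re_cinner bop_apply_times star_bop)
    also have "\<dots> \<le> norm (bop_apply (star T * T) x) * norm x" by (rule norm_cauchy_schwarz)
    also have "\<dots> \<le> K * norm x * norm x"
      using F(2) x unfolding bounded_off_def by (intro mult_right_mono) auto
    also have "\<dots> = (sqrt K * norm x)\<^sup>2"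
      using K by (simp add: power_mult_distrib power2_eq_square)
    finally show "norm (bop_apply T x) \<le> sqrt K * norm x"
      by (rule power2_le_imp_le) (use K in simp)
  qed
  then have "ess_norm T \<le> sqrt K" using K F(1) by (intro ess_norm_le) auto
  then have "(ess_norm T)\<^sup>2 \<le> (sqrt K)\<^sup>2" by (intro power_mono) auto
  then show "(ess_norm T)\<^sup>2 \<le> ess_norm (star T * T) + e" using K by (simp add: K_def)
qed

lemma ess_norm_star [simp]: "ess_norm (star T) = ess_norm T"
proof -
  have le: "ess_norm T \<le> ess_norm (star T)" for T :: "'a bop"
  proof (cases "ess_norm T = 0")
    case False
    then have "ess_norm T > 0" using ess_norm_nonneg[of T] by linarith
    moreover have "ess_norm T * ess_norm T \<le> ess_norm (star T) * ess_norm T"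
      using ess_norm_square_le[of T] ess_norm_mult[of "star T" T] by (simp add: power2_eq_square)
    ultimately show ?thesis by simp
  qed simp
  show ?thesis using le[of T] le[of "star T"] by (simp add: star_star)
qed

lemma ess_norm_cstar: "ess_norm (star T * T) = (ess_norm T)\<^sup>2"
  using ess_norm_square_le[of T] ess_norm_mult[of "star T" T] by (simp add: power2_eq_square)

text \<open>If \<open>F\<close> is a finite \<open>e\<close>-net of the image of the unit ball under \<open>T\<close>, then the adjoint of \<open>T\<close>
  is small off \<open>F\<close>: the norm of \<open>star T x\<close> is a value \<open>inner x (T y)\<close> with \<open>y\<close> in the unit
  ball, and \<open>T y\<close> may be replaced by its difference to a point of \<open>F\<close>.\<close>

lemma ess_norm_compact_op:
  assumes "compact_op T"
  shows "ess_norm T = 0"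
proof -
  have "ess_norm (star T) \<le> 0 + e" if "e > 0" for e
  proof -
    have "compact (closure (bop_apply T ` cball 0 1))"
      using assms by (simp add: compact_op_def)
    then obtain F where F: "finite F" "closure (bop_apply T ` cball 0 1) \<subseteq> (\<Union>f\<in>F. ball f e)"
      using \<open>e > 0\<close> unfolding compact_eq_totally_bounded by metis
    have "bounded_off (star T) F e"
      unfolding bounded_off_def
    proof (intro allI impI)
      fix x assume x: "\<forall>f\<in>F. cinner x f = 0"
      define y where "y = sgn (bop_apply (star T) x)"
      have "norm y \<le> 1" by (simp add: y_def norm_sgn)
      then have "bop_apply T y \<in> closure (bop_apply T ` cball 0 1)"
        by (intro subsetD[OF closure_subset]) simp
      then obtain f where f: "f \<in> F" "norm (bop_apply T y - f) < e"
        using F(2) by (auto simp: dist_norm norm_minus_commute)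
      have "norm (bop_apply (star T) x) = inner (bop_apply (star T) x) y"
        by (simp add: y_def sgn_div_norm dot_square_norm power2_eq_square field_simps)
      also have "\<dots> = inner x (bop_apply T y)" by (simp add: inner_eq_Re_cinner cinner_star_left)
      also have "\<dots> = inner x (bop_apply T y - f)"
        using x f(1) inner_eq_Re_cinner[of x f] by (simp add: inner_diff_right)
      also have "\<dots> \<le> norm x * norm (bop_apply T y - f)" by (rule norm_cauchy_schwarz)
      also have "\<dots> \<le> norm x * e" using f(2) by (intro mult_left_mono) auto
      finally show "norm (bop_apply (star T) x) \<le> e * norm x" by (simp add: mult.commute)
    qed
    then show ?thesis using ess_norm_le[of e F "star T"] F(1) \<open>e > 0\<close> by simp
  qed
  then have "ess_norm (star T) \<le> 0" by (rule field_le_epsilon)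
  then show ?thesis by simp
qed

lemma compact_bounded_combinations:
  fixes v :: "'h \<Rightarrow> 'h::chilbert_space"
  assumes "finite E"
  shows "compact {\<Sum>e\<in>E. c e *\<^sub>C v e | c. \<forall>e\<in>E. cmod (c e) \<le> 1}"
  using assms
proof (induction E)
  case (insert f E)
  let ?C = "{\<Sum>e\<in>E. c e *\<^sub>C v e | c. \<forall>e\<in>E. cmod (c e) \<le> 1}"
  have "bounded_linear (\<lambda>z. z *\<^sub>C v f)"
    by (rule bounded_linear_intro[where K = "norm (v f)"])
      (simp_all add: scaleC_add_left scaleR_scaleC scaleC_scaleC scaleR_conv_of_real
        norm_scaleC_chilbert)
  then have "continuous_on (cball 0 1 \<times> ?C) (\<lambda>p. fst p *\<^sub>C v f + snd p)"
    by (intro continuous_on_add bounded_linear.continuous_on[where f = "\<lambda>z. z *\<^sub>C v f"]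
        continuous_on_fst continuous_on_snd continuous_on_id)
  then have "compact ((\<lambda>p. fst p *\<^sub>C v f + snd p) ` (cball 0 1 \<times> ?C))"
    by (rule compact_continuous_image) (intro compact_Times compact_cball insert.IH)
  moreover have "(\<lambda>p. fst p *\<^sub>C v f + snd p) ` (cball 0 1 \<times> ?C) =
    {\<Sum>e\<in>insert f E. c e *\<^sub>C v e | c. \<forall>e\<in>insert f E. cmod (c e) \<le> 1}" (is "?L = ?R")
  proof
    show "?R \<subseteq> ?L"
    proof
      fix w assume "w \<in> ?R"
      then obtain c where c: "w = (\<Sum>e\<in>insert f E. c e *\<^sub>C v e)" "\<forall>e\<in>insert f E. cmod (c e) \<le> 1"
        by blast
      then have "w = c f *\<^sub>C v f + (\<Sum>e\<in>E. c e *\<^sub>C v e)" using insert by simp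
      then show "w \<in> ?L" using c(2)
        by (intro image_eqI[of _ _ "(c f, \<Sum>e\<in>E. c e *\<^sub>C v e)"]) auto
    qed
    show "?L \<subseteq> ?R"
    proof
      fix w assume "w \<in> ?L"
      then obtain z c where c: "w = z *\<^sub>C v f + (\<Sum>e\<in>E. c e *\<^sub>C v e)" "cmod z \<le> 1"
        "\<forall>e\<in>E. cmod (c e) \<le> 1"
        by auto
      have "w = (\<Sum>e\<in>insert f E. (c(f := z)) e *\<^sub>C v e)"
      proof -
        have "(\<Sum>e\<in>E. (c(f := z)) e *\<^sub>C v e) = (\<Sum>e\<in>E. c e *\<^sub>C v e)"
          using insert.hyps by (intro sum.cong) auto
        then show ?thesis using insert.hyps c(1) by simp
      qed
      moreover have "\<forall>e\<in>insert f E. cmod ((c(f := z)) e) \<le> 1" using c by auto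
      ultimately show "w \<in> ?R" by blast
    qed
  qed
  ultimately show ?case by simp
qed simp

text \<open>If \<open>T\<close> is small off a finite orthonormal set \<open>E\<close>, then subtracting from \<open>x\<close> its expansion in
  \<open>E\<close> shows that the image of the unit ball is close to the compact set of bounded combinations of
  the vectors \<open>T e\<close>.\<close>

lemma compact_op_of_ess_norm_0:
  assumes "ess_norm T = 0"
  shows "compact_op T"
proof -
  let ?B = "bop_apply T ` cball 0 1"
  have "\<exists>k. finite k \<and> closure ?B \<subseteq> (\<Union>x\<in>k. ball x e)" if "e > 0" for e
  proof -
    obtain F where F: "finite F" "bounded_off T F (e/4)"
      using ess_norm_less[of T "e/4"] assms \<open>e > 0\<close> by auto
    obtain E where E: "finite E" "orthonormal_set E"
      "\<And>x. \<forall>e\<in>E. cinner x e = 0 \<Longrightarrow> \<forall>f\<in>F. cinner x f = 0"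
      using gram_schmidt_finite[OF F(1)] by blast
    define C where "C = {\<Sum>f\<in>E. c f *\<^sub>C bop_apply T f | c. \<forall>f\<in>E. cmod (c f) \<le> 1}"
    have "compact C" unfolding C_def by (rule compact_bounded_combinations[OF E(1)])
    then obtain k where k: "finite k" "C \<subseteq> (\<Union>x\<in>k. ball x (e/4))"
      using \<open>e > 0\<close> unfolding compact_eq_totally_bounded
      by (metis zero_less_divide_iff zero_less_numeral)
    have "\<exists>z\<in>k. dist z (bop_apply T x) \<le> e/2" if "norm x \<le> 1" for x
    proof -
      define s where "s = (\<Sum>f\<in>E. cinner x f *\<^sub>C f)"
      have "\<forall>f\<in>F. cinner (x - s) f = 0"
        unfolding s_def by (intro E(3) ballI cinner_orthonormal_residual[OF E(1,2)])
      then have "norm (bop_apply T (x - s)) \<le> e/4 * norm (x - s)"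
        using F(2) by (simp add: bounded_off_def)
      also have "\<dots> \<le> e/4 * 1"
        using norm_orthonormal_residual_le[OF E(1,2), of x] \<open>norm x \<le> 1\<close> \<open>e > 0\<close>
        by (intro mult_left_mono) (auto simp: s_def)
      finally have near: "norm (bop_apply T (x - s)) \<le> e/4" by simp
      have Ts: "bop_apply T s = (\<Sum>f\<in>E. cinner x f *\<^sub>C bop_apply T f)"
        unfolding s_def linear_sum[OF bounded_linear.linear[OF bounded_linear_bop_apply]]
        by (simp add: bop_apply_scaleC)
      have "cmod (cinner x f) \<le> 1" if "f \<in> E" for f
        using cmod_cinner_le[of x f] orthonormal_set_norm[OF E(2) that] \<open>norm x \<le> 1\<close> by simp
      then have "bop_apply T s \<in> C" unfolding C_def Ts by blast
      then obtain z where z: "z \<in> k" "dist z (bop_apply T s) < e/4" using k(2) by auto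
      have "dist (bop_apply T s) (bop_apply T x) = norm (bop_apply T (x - s))"
        by (simp add: dist_norm norm_minus_commute
            linear_diff[OF bounded_linear.linear[OF bounded_linear_bop_apply]])
      then have "dist z (bop_apply T x) \<le> e/2"
        using near z(2) dist_triangle[of z "bop_apply T x" "bop_apply T s"] by simp
      then show ?thesis using z(1) by blast
    qed
    then have "?B \<subseteq> (\<Union>z\<in>k. cball z (e/2))" by fastforce
    then have "closure ?B \<subseteq> (\<Union>z\<in>k. cball z (e/2))"
      using k(1) by (intro closure_minimal closed_UN) auto
    also have "\<dots> \<subseteq> (\<Union>z\<in>k. ball z e)" using \<open>e > 0\<close> by (intro UN_mono) auto
    finally show ?thesis using k(1) by blast
  qed
  then show ?thesis
    unfolding compact_op_def compact_eq_totally_bounded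
    by (simp add: complete_eq_closed)
qed

section \<open>Equality modulo compact operators\<close>

definition ess_eq :: "'h::chilbert_space bop \<Rightarrow> 'h bop \<Rightarrow> bool"  (infix \<open>\<approx>\<^sub>K\<close> 50) where
  "S \<approx>\<^sub>K T \<longleftrightarrow> ess_norm (S - T) = 0"

lemma ess_eq_refl [simp]: "S \<approx>\<^sub>K S"
  by (simp add: ess_eq_def)

lemma ess_eq_sym: "S \<approx>\<^sub>K T \<Longrightarrow> T \<approx>\<^sub>K S"
  by (simp add: ess_eq_def ess_norm_minus_commute)

lemma ess_eq_trans [trans]: "R \<approx>\<^sub>K S \<Longrightarrow> S \<approx>\<^sub>K T \<Longrightarrow> R \<approx>\<^sub>K T"
  using ess_norm_diff_triangle[of R T S] by (simp add: ess_eq_def)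

lemma ess_eq_add: "S \<approx>\<^sub>K S' \<Longrightarrow> T \<approx>\<^sub>K T' \<Longrightarrow> S + T \<approx>\<^sub>K S' + T'"
  using ess_norm_add[of "S - S'" "T - T'"]
  by (simp add: ess_eq_def algebra_simps)

lemma ess_eq_mult_left:
  assumes "T \<approx>\<^sub>K T'" shows "S * T \<approx>\<^sub>K S * T'"
  using assms ess_norm_mult[of S "T - T'"]
  by (simp add: ess_eq_def right_diff_distrib)

lemma ess_eq_mult_right:
  assumes "T \<approx>\<^sub>K T'" shows "T * S \<approx>\<^sub>K T' * S"
  using assms ess_norm_mult[of "T - T'" S]
  by (simp add: ess_eq_def left_diff_distrib)

lemma ess_norm_cong:
  assumes "S \<approx>\<^sub>K T" shows "ess_norm S = ess_norm T"
  using assms ess_norm_add[of "S - T" T] ess_norm_add[of "T - S" S]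
  by (simp add: ess_eq_def ess_norm_minus_commute)

lemma ess_norm_diff_cong:
  assumes "S \<approx>\<^sub>K S'" "T \<approx>\<^sub>K T'" shows "ess_norm (S - T) = ess_norm (S' - T')"
proof (rule ess_norm_cong)
  have "- T \<approx>\<^sub>K - T'" using ess_eq_sym[OF assms(2)] by (simp add: ess_eq_def)
  then show "S - T \<approx>\<^sub>K S' - T'" using ess_eq_add[OF assms(1)] by fastforce
qed

section \<open>The tensor product representation modulo compact operators\<close>

locale ess_commuting_reps =
  fixes \<pi>1 :: "'a::unital_cstar_algebra \<Rightarrow> 'h::chilbert_space bop"
    and \<pi>2 :: "'b::unital_cstar_algebra \<Rightarrow> 'h bop"
  assumes hom1: "star_hom \<pi>1" and hom2: "star_hom \<pi>2"
    and commutator_compact: "\<And>x y. compact_op (\<pi>1 x * \<pi>2 y - \<pi>2 y * \<pi>1 x)"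
begin

lemma rep_simps:
  "\<pi>1 (x + x') = \<pi>1 x + \<pi>1 x'" "\<pi>1 (x * x') = \<pi>1 x * \<pi>1 x'"
  "\<pi>1 (c *\<^sub>C x) = c *\<^sub>C \<pi>1 x" "\<pi>1 (star x) = star (\<pi>1 x)"
  "\<pi>2 (y + y') = \<pi>2 y + \<pi>2 y'" "\<pi>2 (y * y') = \<pi>2 y * \<pi>2 y'"
  "\<pi>2 (c *\<^sub>C y) = c *\<^sub>C \<pi>2 y" "\<pi>2 (star y) = star (\<pi>2 y)"
  using hom1 hom2 by (simp_all add: star_hom_on_def)

lemma reps_ess_commute: "\<pi>2 y * \<pi>1 x \<approx>\<^sub>K \<pi>1 x * \<pi>2 y"
  using ess_norm_compact_op[OF commutator_compact[of x y]]
  by (simp add: ess_eq_def ess_norm_minus_commute)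

definition tensor_rep :: "('a, 'b) tensor \<Rightarrow> 'h bop" where
  "tensor_rep = (THE F. (\<forall>s t. F (s + t) = F s + F t) \<and> (\<forall>c t. F (c *\<^sub>C t) = c *\<^sub>C F t) \<and>
    (\<forall>x y. F (x \<otimes> y) = \<pi>1 x * \<pi>2 y))"

lemma
  shows tensor_rep_add: "tensor_rep (s + t) = tensor_rep s + tensor_rep t"
    and tensor_rep_scaleC: "tensor_rep (c *\<^sub>C t) = c *\<^sub>C tensor_rep t"
    and tensor_rep_tensor: "tensor_rep (x \<otimes> y) = \<pi>1 x * \<pi>2 y"
proof -
  have "\<exists>!F. (\<forall>s t. F (s + t) = F s + F t) \<and> (\<forall>c t. F (c *\<^sub>C t) = c *\<^sub>C F t) \<and>
    (\<forall>x y. F (x \<otimes> y) = \<pi>1 x * \<pi>2 y)"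
    by (rule tensor_universal_property)
      (simp_all add: rep_simps distrib_left distrib_right mult_scaleC_left mult_scaleC_right)
  from theI'[OF this] show "tensor_rep (s + t) = tensor_rep s + tensor_rep t"
    "tensor_rep (c *\<^sub>C t) = c *\<^sub>C tensor_rep t" "tensor_rep (x \<otimes> y) = \<pi>1 x * \<pi>2 y"
    unfolding tensor_rep_def by blast+
qed

lemma tensor_rep_0: "tensor_rep 0 = 0"
  using tensor_rep_add[of 0 0] by simp

lemma tensor_rep_sum: "tensor_rep (sum f A) = (\<Sum>a\<in>A. tensor_rep (f a))"
  by (induction A rule: infinite_finite_induct) (simp_all add: tensor_rep_0 tensor_rep_add)

lemma tensor_rep_mult: "tensor_rep (s * t) \<approx>\<^sub>K tensor_rep s * tensor_rep t"
proof -
  have elementary: "tensor_rep (x \<otimes> y * (x' \<otimes> y')) \<approx>\<^sub>K tensor_rep (x \<otimes> y) * tensor_rep (x' \<otimes> y')"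
    for x x' y y'
    using ess_eq_mult_left[OF ess_eq_mult_right[OF ess_eq_sym[OF reps_ess_commute[of y x']]],
        of "\<pi>1 x" "\<pi>2 y'"]
    by (simp add: tensor_mult tensor_rep_tensor rep_simps mult.assoc)
  have left: "tensor_rep (x \<otimes> y * t) \<approx>\<^sub>K tensor_rep (x \<otimes> y) * tensor_rep t" for x y t
    by (induction t rule: tensor_induct)
      (simp_all add: tensor_rep_0 tensor_rep_add distrib_left elementary ess_eq_add)
  show ?thesis
    by (induction s rule: tensor_induct)
      (simp_all add: tensor_rep_0 tensor_rep_add distrib_right left ess_eq_add)
qed

lemma tensor_rep_star: "tensor_rep (star t) \<approx>\<^sub>K star (tensor_rep t)"
proof (induction t rule: tensor_induct)
  case (2 x y t)
  have "tensor_rep (star (x \<otimes> y)) \<approx>\<^sub>K star (tensor_rep (x \<otimes> y))"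
    using ess_eq_sym[OF reps_ess_commute[of "star y" "star x"]]
    by (simp add: tensor_star tensor_rep_tensor rep_simps star_mult)
  then show ?case using 2 by (simp add: star_add tensor_rep_add ess_eq_add)
qed (simp add: star_zero tensor_rep_0)

text \<open>Injectivity of \<open>tensor_rep\<close> modulo compact operators is exactly what turns the essential norm
  into a norm on the algebraic tensor product.\<close>

lemma cstar_norm_ess_norm_tensor_rep:
  assumes "\<And>t. compact_op (tensor_rep t) \<Longrightarrow> t = 0"
  shows "cstar_norm (\<lambda>t. ess_norm (tensor_rep t))"
  unfolding cstar_norm_def
proof (intro conjI allI)
  fix s t :: "('a, 'b) tensor" and c :: complex
  show "ess_norm (tensor_rep t) = 0 \<longleftrightarrow> t = 0"
    using assms compact_op_of_ess_norm_0 by (auto simp: tensor_rep_0)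
  show "ess_norm (tensor_rep (s + t)) \<le> ess_norm (tensor_rep s) + ess_norm (tensor_rep t)"
    by (simp add: tensor_rep_add ess_norm_add)
  show "ess_norm (tensor_rep (c *\<^sub>C t)) = cmod c * ess_norm (tensor_rep t)"
    by (simp add: tensor_rep_scaleC ess_norm_scaleC)
  show "ess_norm (tensor_rep (s * t)) \<le> ess_norm (tensor_rep s) * ess_norm (tensor_rep t)"
    using ess_norm_cong[OF tensor_rep_mult] ess_norm_mult by metis
  have "tensor_rep (star t * t) \<approx>\<^sub>K star (tensor_rep t) * tensor_rep t"
    using ess_eq_trans[OF tensor_rep_mult ess_eq_mult_right[OF tensor_rep_star]] .
  then show "ess_norm (tensor_rep (star t * t)) = (ess_norm (tensor_rep t))\<^sup>2"
    using ess_norm_cong ess_norm_cstar by metis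
qed simp

text \<open>The operator that represents \<open>1 \<otimes> 1\<close>. Modulo compact operators it is a projection and a unit
  for the range of \<open>tensor_rep\<close>, and it moves both \<open>\<pi>1 x\<close> and \<open>\<pi>2 y\<close> into that range. If both
  representations are unital it is the identity.\<close>

definition unit_rep :: "'h bop" where
  "unit_rep = tensor_rep (1 \<otimes> 1)"

lemma unit_rep_mult:
  "unit_rep * tensor_rep t \<approx>\<^sub>K tensor_rep t" "tensor_rep t * unit_rep \<approx>\<^sub>K tensor_rep t"
  using ess_eq_sym[OF tensor_rep_mult, of "1 \<otimes> 1" t] ess_eq_sym[OF tensor_rep_mult, of t "1 \<otimes> 1"]
  by (simp_all add: unit_rep_def tensor_one_mult)

lemma star_unit_rep: "star unit_rep \<approx>\<^sub>K unit_rep"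
  using ess_eq_sym[OF tensor_rep_star[of "1 \<otimes> 1"]]
  by (simp add: unit_rep_def tensor_star star_one)

lemma rep1_unit_rep: "\<pi>1 x * unit_rep \<approx>\<^sub>K tensor_rep (x \<otimes> 1)"
  "unit_rep * \<pi>1 x \<approx>\<^sub>K tensor_rep (x \<otimes> 1)"
proof -
  have one: "\<pi>1 x * \<pi>1 1 = \<pi>1 x" "\<pi>1 1 * \<pi>1 x = \<pi>1 x" by (simp_all flip: rep_simps)
  show "\<pi>1 x * unit_rep \<approx>\<^sub>K tensor_rep (x \<otimes> 1)"
    by (simp add: unit_rep_def tensor_rep_tensor one flip: mult.assoc)
  have "\<pi>1 1 * (\<pi>2 1 * \<pi>1 x) \<approx>\<^sub>K \<pi>1 1 * (\<pi>1 x * \<pi>2 1)"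
    by (rule ess_eq_mult_left[OF reps_ess_commute])
  then show "unit_rep * \<pi>1 x \<approx>\<^sub>K tensor_rep (x \<otimes> 1)"
    by (simp add: unit_rep_def tensor_rep_tensor mult.assoc one flip: mult.assoc[of "\<pi>1 1" "\<pi>1 x"])
qed

lemma rep2_unit_rep: "\<pi>2 y * unit_rep \<approx>\<^sub>K tensor_rep (1 \<otimes> y)"
  "unit_rep * \<pi>2 y \<approx>\<^sub>K tensor_rep (1 \<otimes> y)"
proof -
  have one: "\<pi>2 y * \<pi>2 1 = \<pi>2 y" "\<pi>2 1 * \<pi>2 y = \<pi>2 y" by (simp_all flip: rep_simps)
  have "\<pi>2 y * \<pi>1 1 * \<pi>2 1 \<approx>\<^sub>K \<pi>1 1 * \<pi>2 y * \<pi>2 1"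
    by (rule ess_eq_mult_right[OF reps_ess_commute])
  then show "\<pi>2 y * unit_rep \<approx>\<^sub>K tensor_rep (1 \<otimes> y)"
    by (simp add: unit_rep_def tensor_rep_tensor mult.assoc one)
  show "unit_rep * \<pi>2 y \<approx>\<^sub>K tensor_rep (1 \<otimes> y)"
    by (simp add: unit_rep_def tensor_rep_tensor mult.assoc one)
qed

end

section \<open>The symbol\<close>

locale symbol_setting = ess_commuting_reps \<pi>1 \<pi>2
  for \<pi>1 :: "'a::unital_cstar_algebra \<Rightarrow> 'h::chilbert_space bop"
    and \<pi>2 :: "'b::unital_cstar_algebra \<Rightarrow> 'h bop" +
  fixes \<iota> :: "('a, 'b) tensor \<Rightarrow> 'c::cstar_algebra"
  assumes hom_\<iota>: "star_hom \<iota>"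
    and norm_\<iota>_le: "\<And>t. norm (\<iota> t) \<le> ess_norm (tensor_rep t)"
begin

lemma \<iota>_simps: "\<iota> (s + t) = \<iota> s + \<iota> t" "\<iota> (s * t) = \<iota> s * \<iota> t"
  "\<iota> (c *\<^sub>C t) = c *\<^sub>C \<iota> t" "\<iota> (star t) = star (\<iota> t)"
  using hom_\<iota> by (simp_all add: star_hom_on_def)

text \<open>The graph of the symbol. Compressing by \<open>unit_rep\<close> absorbs the failure of \<open>\<pi>1\<close> and \<open>\<pi>2\<close> to be
  unital; it is required on both sides because taking adjoints exchanges the two conditions.\<close>

definition symbol_rel :: "'h bop \<Rightarrow> 'c \<Rightarrow> bool" where
  "symbol_rel T c \<longleftrightarrow> (\<exists>t. (\<lambda>n. ess_norm (T * unit_rep - tensor_rep (t n))) \<longlonglongrightarrow> 0 \<and>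
    (\<lambda>n. ess_norm (unit_rep * T - tensor_rep (t n))) \<longlonglongrightarrow> 0 \<and> (\<lambda>n. \<iota> (t n)) \<longlonglongrightarrow> c)"

lemma symbol_relI:
  assumes "a \<longlonglongrightarrow> 0" "b \<longlonglongrightarrow> 0" "(\<lambda>n. \<iota> (t n)) \<longlonglongrightarrow> c"
    and "\<And>n. ess_norm (T * unit_rep - tensor_rep (t n)) \<le> a n"
    and "\<And>n. ess_norm (unit_rep * T - tensor_rep (t n)) \<le> b n"
  shows "symbol_rel T c"
  unfolding symbol_rel_def
proof (intro exI[of _ t] conjI assms(3))
  show "(\<lambda>n. ess_norm (T * unit_rep - tensor_rep (t n))) \<longlonglongrightarrow> 0"
    by (rule tendsto_sandwich[OF _ _ tendsto_const assms(1)]) (simp_all add: assms(4))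
  show "(\<lambda>n. ess_norm (unit_rep * T - tensor_rep (t n))) \<longlonglongrightarrow> 0"
    by (rule tendsto_sandwich[OF _ _ tendsto_const assms(2)]) (simp_all add: assms(5))
qed

lemma symbol_rel_tensor:
  assumes "T * unit_rep \<approx>\<^sub>K tensor_rep t" "unit_rep * T \<approx>\<^sub>K tensor_rep t"
  shows "symbol_rel T (\<iota> t)"
  using assms by (intro symbol_relI[of "\<lambda>_. 0" "\<lambda>_. 0" "\<lambda>_. t"]) (auto simp: ess_eq_def)

lemma symbol_rel_0: "symbol_rel 0 0"
  using symbol_rel_tensor[of 0 0] by (simp add: tensor_rep_0 star_hom_0[OF hom_\<iota>])

lemma symbol_rel_add:
  assumes "symbol_rel S c" "symbol_rel T d"
  shows "symbol_rel (S + T) (c + d)"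
proof -
  obtain s where s: "(\<lambda>n. ess_norm (S * unit_rep - tensor_rep (s n))) \<longlonglongrightarrow> 0"
    "(\<lambda>n. ess_norm (unit_rep * S - tensor_rep (s n))) \<longlonglongrightarrow> 0" "(\<lambda>n. \<iota> (s n)) \<longlonglongrightarrow> c"
    using assms(1) unfolding symbol_rel_def by blast
  obtain t where t: "(\<lambda>n. ess_norm (T * unit_rep - tensor_rep (t n))) \<longlonglongrightarrow> 0"
    "(\<lambda>n. ess_norm (unit_rep * T - tensor_rep (t n))) \<longlonglongrightarrow> 0" "(\<lambda>n. \<iota> (t n)) \<longlonglongrightarrow> d"
    using assms(2) unfolding symbol_rel_def by blast
  show ?thesis
  proof (rule symbol_relI)
    show "(\<lambda>n. \<iota> (s n + t n)) \<longlonglongrightarrow> c + d" unfolding \<iota>_simps by (intro tendsto_add s t)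
    show "ess_norm ((S + T) * unit_rep - tensor_rep (s n + t n)) \<le>
      ess_norm (S * unit_rep - tensor_rep (s n)) + ess_norm (T * unit_rep - tensor_rep (t n))" for n
      using ess_norm_add[of "S * unit_rep - tensor_rep (s n)" "T * unit_rep - tensor_rep (t n)"]
      by (simp add: tensor_rep_add algebra_simps)
    show "ess_norm (unit_rep * (S + T) - tensor_rep (s n + t n)) \<le>
      ess_norm (unit_rep * S - tensor_rep (s n)) + ess_norm (unit_rep * T - tensor_rep (t n))" for n
      using ess_norm_add[of "unit_rep * S - tensor_rep (s n)" "unit_rep * T - tensor_rep (t n)"]
      by (simp add: tensor_rep_add algebra_simps)
  qed (use tendsto_add[OF s(1) t(1)] tendsto_add[OF s(2) t(2)] in auto)
qed

lemma symbol_rel_scaleC: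
  assumes "symbol_rel T c"
  shows "symbol_rel (z *\<^sub>C T) (z *\<^sub>C c)"
proof -
  obtain t where t: "(\<lambda>n. ess_norm (T * unit_rep - tensor_rep (t n))) \<longlonglongrightarrow> 0"
    "(\<lambda>n. ess_norm (unit_rep * T - tensor_rep (t n))) \<longlonglongrightarrow> 0" "(\<lambda>n. \<iota> (t n)) \<longlonglongrightarrow> c"
    using assms unfolding symbol_rel_def by blast
  have "bounded_linear (\<lambda>c::'c. z *\<^sub>C c)"
    by (rule bounded_linear_intro[where K = "cmod z"])
      (simp_all add: scaleC_add_right scaleR_scaleC scaleC_scaleC norm_scaleC mult.commute)
  show ?thesis
  proof (rule symbol_relI)
    show "(\<lambda>n. \<iota> (z *\<^sub>C t n)) \<longlonglongrightarrow> z *\<^sub>C c"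
      unfolding \<iota>_simps by (rule bounded_linear.tendsto) fact+
    show "ess_norm (z *\<^sub>C T * unit_rep - tensor_rep (z *\<^sub>C t n)) \<le>
      cmod z * ess_norm (T * unit_rep - tensor_rep (t n))" for n
      by (simp add: tensor_rep_scaleC mult_scaleC_left ess_norm_scaleC flip: scaleC_diff_right)
    show "ess_norm (unit_rep * (z *\<^sub>C T) - tensor_rep (z *\<^sub>C t n)) \<le>
      cmod z * ess_norm (unit_rep * T - tensor_rep (t n))" for n
      by (simp add: tensor_rep_scaleC mult_scaleC_right ess_norm_scaleC flip: scaleC_diff_right)
  qed (use t tendsto_mult_left[OF t(1), of "cmod z"] tendsto_mult_left[OF t(2), of "cmod z"] in auto)
qed

lemma symbol_rel_star:
  assumes "symbol_rel T c"
  shows "symbol_rel (star T) (star c)"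
proof -
  obtain t where t: "(\<lambda>n. ess_norm (T * unit_rep - tensor_rep (t n))) \<longlonglongrightarrow> 0"
    "(\<lambda>n. ess_norm (unit_rep * T - tensor_rep (t n))) \<longlonglongrightarrow> 0" "(\<lambda>n. \<iota> (t n)) \<longlonglongrightarrow> c"
    using assms unfolding symbol_rel_def by blast
  show ?thesis
  proof (rule symbol_relI[OF t(2) t(1)])
    show "(\<lambda>n. \<iota> (star (t n))) \<longlonglongrightarrow> star c" unfolding \<iota>_simps by (rule tendsto_star[OF t(3)])
    fix n
    have "ess_norm (star T * unit_rep - tensor_rep (star (t n))) =
        ess_norm (star T * star unit_rep - star (tensor_rep (t n)))"
      by (intro ess_norm_diff_cong ess_eq_mult_left tensor_rep_star ess_eq_sym[OF star_unit_rep])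
    also have "\<dots> = ess_norm (star (unit_rep * T - tensor_rep (t n)))"
      by (simp only: star_mult star_diff)
    finally show "ess_norm (star T * unit_rep - tensor_rep (star (t n))) \<le>
      ess_norm (unit_rep * T - tensor_rep (t n))" by simp
    have "ess_norm (unit_rep * star T - tensor_rep (star (t n))) =
        ess_norm (star unit_rep * star T - star (tensor_rep (t n)))"
      by (intro ess_norm_diff_cong ess_eq_mult_right tensor_rep_star ess_eq_sym[OF star_unit_rep])
    also have "\<dots> = ess_norm (star (T * unit_rep - tensor_rep (t n)))"
      by (simp only: star_mult star_diff)
    finally show "ess_norm (unit_rep * star T - tensor_rep (star (t n))) \<le>
      ess_norm (T * unit_rep - tensor_rep (t n))" by simp
  qed
qed

text \<open>In \<open>S * T * unit_rep\<close>, first \<open>T * unit_rep\<close> is replaced by \<open>tensor_rep t\<close>; as this absorbs a factor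
  \<open>unit_rep\<close> on its left, \<open>S * unit_rep\<close> can then be replaced by \<open>tensor_rep s\<close>.\<close>

lemma tensor_rep_approx_mult:
  "ess_norm (S * T * unit_rep - tensor_rep (s * t)) \<le>
    ess_norm S * ess_norm (T * unit_rep - tensor_rep t) +
    ess_norm (S * unit_rep - tensor_rep s) * ess_norm (tensor_rep t)" (is ?left)
  "ess_norm (unit_rep * (S * T) - tensor_rep (s * t)) \<le>
    ess_norm (unit_rep * S - tensor_rep s) * ess_norm T +
    ess_norm (tensor_rep s) * ess_norm (unit_rep * T - tensor_rep t)" (is ?right)
proof -
  have "ess_norm (S * tensor_rep t - tensor_rep (s * t)) =
      ess_norm (S * (unit_rep * tensor_rep t) - tensor_rep s * tensor_rep t)"
    by (intro ess_norm_diff_cong tensor_rep_mult ess_eq_mult_left ess_eq_sym[OF unit_rep_mult(1)])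
  also have "\<dots> \<le> ess_norm (S * unit_rep - tensor_rep s) * ess_norm (tensor_rep t)"
    using ess_norm_mult[of "S * unit_rep - tensor_rep s" "tensor_rep t"]
    by (simp add: left_diff_distrib mult.assoc)
  finally show ?left
    using ess_norm_diff_triangle[of "S * T * unit_rep" "tensor_rep (s * t)" "S * tensor_rep t"]
      ess_norm_mult[of S "T * unit_rep - tensor_rep t"]
    by (simp add: right_diff_distrib mult.assoc)
  have "ess_norm (tensor_rep s * T - tensor_rep (s * t)) =
      ess_norm (tensor_rep s * unit_rep * T - tensor_rep s * tensor_rep t)"
    by (intro ess_norm_diff_cong tensor_rep_mult ess_eq_mult_right ess_eq_sym[OF unit_rep_mult(2)])
  also have "\<dots> \<le> ess_norm (tensor_rep s) * ess_norm (unit_rep * T - tensor_rep t)"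
    using ess_norm_mult[of "tensor_rep s" "unit_rep * T - tensor_rep t"]
    by (simp add: right_diff_distrib mult.assoc)
  finally show ?right
    using ess_norm_diff_triangle[of "unit_rep * (S * T)" "tensor_rep (s * t)" "tensor_rep s * T"]
      ess_norm_mult[of "unit_rep * S - tensor_rep s" T]
    by (simp add: left_diff_distrib mult.assoc)
qed

lemma symbol_rel_mult:
  assumes "symbol_rel S c" "symbol_rel T d"
  shows "symbol_rel (S * T) (c * d)"
proof -
  obtain s where s: "(\<lambda>n. ess_norm (S * unit_rep - tensor_rep (s n))) \<longlonglongrightarrow> 0"
    "(\<lambda>n. ess_norm (unit_rep * S - tensor_rep (s n))) \<longlonglongrightarrow> 0" "(\<lambda>n. \<iota> (s n)) \<longlonglongrightarrow> c"
    using assms(1) unfolding symbol_rel_def by blast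
  obtain t where t: "(\<lambda>n. ess_norm (T * unit_rep - tensor_rep (t n))) \<longlonglongrightarrow> 0"
    "(\<lambda>n. ess_norm (unit_rep * T - tensor_rep (t n))) \<longlonglongrightarrow> 0" "(\<lambda>n. \<iota> (t n)) \<longlonglongrightarrow> d"
    using assms(2) unfolding symbol_rel_def by blast
  let ?a = "\<lambda>n. ess_norm (S * unit_rep - tensor_rep (s n))"
  let ?a' = "\<lambda>n. ess_norm (unit_rep * S - tensor_rep (s n))"
  let ?b = "\<lambda>n. ess_norm (T * unit_rep - tensor_rep (t n))"
  let ?b' = "\<lambda>n. ess_norm (unit_rep * T - tensor_rep (t n))"
  \<comment> \<open>Keeps the essential norms of \<open>tensor_rep (s n)\<close> and \<open>tensor_rep (t n)\<close> bounded.\<close>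
  have bound: "ess_norm R' \<le> ess_norm R + ess_norm (R - R')" for R R' :: "'h bop"
    using ess_norm_add[of R "R' - R"] by (simp add: ess_norm_minus_commute)
  show ?thesis
  proof (rule symbol_relI)
    show "(\<lambda>n. \<iota> (s n * t n)) \<longlonglongrightarrow> c * d" unfolding \<iota>_simps by (intro tendsto_mult s t)
    have "(\<lambda>n. ess_norm S * ?b n + ?a n * (ess_norm (T * unit_rep) + ?b n)) \<longlonglongrightarrow>
      ess_norm S * 0 + 0 * (ess_norm (T * unit_rep) + 0)"
      by (intro tendsto_intros s t)
    then show "(\<lambda>n. ess_norm S * ?b n + ?a n * (ess_norm (T * unit_rep) + ?b n)) \<longlonglongrightarrow> 0" by simp
    have "(\<lambda>n. ?a' n * ess_norm T + (ess_norm (unit_rep * S) + ?a' n) * ?b' n) \<longlonglongrightarrow>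
      0 * ess_norm T + (ess_norm (unit_rep * S) + 0) * 0"
      by (intro tendsto_intros s t)
    then show "(\<lambda>n. ?a' n * ess_norm T + (ess_norm (unit_rep * S) + ?a' n) * ?b' n) \<longlonglongrightarrow> 0" by simp
    show "ess_norm (S * T * unit_rep - tensor_rep (s n * t n)) \<le>
      ess_norm S * ?b n + ?a n * (ess_norm (T * unit_rep) + ?b n)" for n
      by (intro order_trans[OF tensor_rep_approx_mult(1)] add_mono mult_left_mono bound) simp_all
    show "ess_norm (unit_rep * (S * T) - tensor_rep (s n * t n)) \<le>
      ?a' n * ess_norm T + (ess_norm (unit_rep * S) + ?a' n) * ?b' n" for n
      by (intro order_trans[OF tensor_rep_approx_mult(2)] add_mono mult_right_mono bound) simp_all
  qed
qed

text \<open>The only place where the comparison of the two norms on the algebraic tensor product enters. It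
  makes the symbol single-valued and continuous.\<close>

lemma symbol_rel_norm_le:
  assumes "symbol_rel T c"
  shows "norm c \<le> norm unit_rep * norm T"
proof -
  obtain t where t: "(\<lambda>n. ess_norm (T * unit_rep - tensor_rep (t n))) \<longlonglongrightarrow> 0" "(\<lambda>n. \<iota> (t n)) \<longlonglongrightarrow> c"
    using assms unfolding symbol_rel_def by blast
  have "norm (\<iota> (t n)) \<le> norm unit_rep * norm T + ess_norm (T * unit_rep - tensor_rep (t n))" for n
  proof -
    have "norm (\<iota> (t n)) \<le> ess_norm (tensor_rep (t n))" by (rule norm_\<iota>_le)
    also have "\<dots> \<le> ess_norm (T * unit_rep) + ess_norm (T * unit_rep - tensor_rep (t n))"
      using ess_norm_add[of "T * unit_rep" "tensor_rep (t n) - T * unit_rep"]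
      by (simp add: ess_norm_minus_commute)
    also have "ess_norm (T * unit_rep) \<le> norm unit_rep * norm T"
      using ess_norm_le_norm[of "T * unit_rep"] norm_mult_ineq[of T unit_rep]
      by (simp add: mult.commute)
    finally show ?thesis by simp
  qed
  moreover have "(\<lambda>n. norm unit_rep * norm T + ess_norm (T * unit_rep - tensor_rep (t n)))
      \<longlonglongrightarrow> norm unit_rep * norm T + 0"
    by (intro tendsto_intros t)
  ultimately show ?thesis
    using LIMSEQ_le[OF tendsto_norm[OF t(2)]] by auto
qed

lemma symbol_rel_diff:
  assumes "symbol_rel S c" "symbol_rel T d"
  shows "symbol_rel (S - T) (c - d)"
  using symbol_rel_add[OF assms(1) symbol_rel_scaleC[OF assms(2), of "-1"]]
  by (simp add: scaleC_minus_one)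

lemma symbol_rel_unique: "symbol_rel T c \<Longrightarrow> symbol_rel T d \<Longrightarrow> c = d"
  using symbol_rel_norm_le[OF symbol_rel_diff] by fastforce

lemma symbol_rel_closed:
  assumes "X \<longlonglongrightarrow> T" "\<And>n. symbol_rel (X n) (c n)" "c \<longlonglongrightarrow> d"
  shows "symbol_rel T d"
proof -
  have "\<exists>t. ess_norm (X n * unit_rep - tensor_rep t) < 1 / real (Suc n) \<and>
    ess_norm (unit_rep * X n - tensor_rep t) < 1 / real (Suc n) \<and>
    dist (\<iota> t) (c n) < 1 / real (Suc n)" for n
  proof -
    obtain t where t: "(\<lambda>k. ess_norm (X n * unit_rep - tensor_rep (t k))) \<longlonglongrightarrow> 0"
      "(\<lambda>k. ess_norm (unit_rep * X n - tensor_rep (t k))) \<longlonglongrightarrow> 0" "(\<lambda>k. \<iota> (t k)) \<longlonglongrightarrow> c n"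
      using assms(2) unfolding symbol_rel_def by blast
    have "1 / real (Suc n) > 0" by simp
    from order_tendstoD(2)[OF t(1) this] order_tendstoD(2)[OF t(2) this] tendstoD[OF t(3) this]
    have "\<forall>\<^sub>F k in sequentially. ess_norm (X n * unit_rep - tensor_rep (t k)) < 1 / real (Suc n) \<and>
      ess_norm (unit_rep * X n - tensor_rep (t k)) < 1 / real (Suc n) \<and>
      dist (\<iota> (t k)) (c n) < 1 / real (Suc n)"
      by (intro eventually_conj)
    then show ?thesis unfolding eventually_sequentially by blast
  qed
  then obtain t where t: "\<And>n. ess_norm (X n * unit_rep - tensor_rep (t n)) < 1 / real (Suc n)"
    "\<And>n. ess_norm (unit_rep * X n - tensor_rep (t n)) < 1 / real (Suc n)"
    "\<And>n. dist (\<iota> (t n)) (c n) < 1 / real (Suc n)"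
    by metis
  have small: "(\<lambda>n. 1 / real (Suc n)) \<longlonglongrightarrow> 0" by (rule LIMSEQ_Suc[OF lim_1_over_n])
  let ?b = "\<lambda>n. norm (T - X n) * norm unit_rep + 1 / real (Suc n)"
  have "?b \<longlonglongrightarrow> norm (T - T) * norm unit_rep + 0"
    by (intro tendsto_intros assms(1) small)
  then have b: "?b \<longlonglongrightarrow> 0" by simp
  show ?thesis
  proof (rule symbol_relI[OF b b])
    have "(\<lambda>n. \<iota> (t n) - c n) \<longlonglongrightarrow> 0"
      by (rule Lim_null_comparison[OF always_eventually small])
        (use t(3) in \<open>auto simp: dist_norm intro: less_imp_le\<close>)
    from tendsto_add[OF this assms(3)] show "(\<lambda>n. \<iota> (t n)) \<longlonglongrightarrow> d" by simp
    show "ess_norm (T * unit_rep - tensor_rep (t n)) \<le> ?b n" for n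
    proof -
      have "ess_norm ((T - X n) * unit_rep) \<le> norm (T - X n) * norm unit_rep"
        by (rule order_trans[OF ess_norm_le_norm norm_mult_ineq])
      then show ?thesis
        using ess_norm_diff_triangle[of "T * unit_rep" "tensor_rep (t n)" "X n * unit_rep"] t(1)[of n]
        by (simp add: left_diff_distrib)
    qed
    show "ess_norm (unit_rep * T - tensor_rep (t n)) \<le> ?b n" for n
    proof -
      have "ess_norm (unit_rep * (T - X n)) \<le> norm unit_rep * norm (T - X n)"
        by (rule order_trans[OF ess_norm_le_norm norm_mult_ineq])
      then show ?thesis
        using ess_norm_diff_triangle[of "unit_rep * T" "tensor_rep (t n)" "unit_rep * X n"] t(2)[of n]
        by (simp add: right_diff_distrib mult.commute)
    qed
  qed
qed

text \<open>The symbols of a convergent sequence are Cauchy by the Lipschitz bound, so their limit is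
  available as the symbol of the limit operator.\<close>

lemma closed_symbol_domain: "closed {T. \<exists>c. symbol_rel T c}"
  unfolding closed_sequential_limits
proof (intro allI impI, elim conjE)
  fix X T assume "\<forall>n. X n \<in> {T. \<exists>c. symbol_rel T c}" and X: "X \<longlonglongrightarrow> T"
  then obtain c where c: "\<And>n. symbol_rel (X n) (c n)" by (auto, metis)
  \<comment> \<open>The summand 1 makes the Lipschitz constant positive even if \<open>unit_rep\<close> vanishes.\<close>
  have lip: "norm (c m - c n) \<le> (norm unit_rep + 1) * norm (X m - X n)" for m n
    using symbol_rel_norm_le[OF symbol_rel_diff[OF c c], of m n] norm_ge_zero[of "X m - X n"]
    unfolding distrib_right by linarith
  have "Cauchy c"
  proof (rule CauchyI)
    fix e :: real assume "e > 0"
    have pos: "norm (unit_rep :: 'h bop) + 1 > 0" by (rule add_nonneg_pos) simp_all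
    obtain M where M: "\<And>m n. m \<ge> M \<Longrightarrow> n \<ge> M \<Longrightarrow> norm (X m - X n) < e / (norm unit_rep + 1)"
      using CauchyD[OF LIMSEQ_imp_Cauchy[OF X] divide_pos_pos[OF \<open>e > 0\<close> pos]] by blast
    have "norm (c m - c n) < e" if "m \<ge> M" "n \<ge> M" for m n
      using lip[of m n] M[OF that] pos by (simp add: pos_less_divide_eq mult.commute)
    then show "\<exists>M. \<forall>m\<ge>M. \<forall>n\<ge>M. norm (c m - c n) < e" by blast
  qed
  then obtain d where "c \<longlonglongrightarrow> d" using Cauchy_convergent convergent_def by blast
  then show "T \<in> {T. \<exists>c. symbol_rel T c}" using symbol_rel_closed[OF X c] by blast
qed

lemma star_subalgebra_symbol_domain: "star_subalgebra {T. \<exists>c. symbol_rel T c}"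
  unfolding star_subalgebra_def
  by (intro conjI ballI allI; clarsimp;
      meson symbol_rel_0 symbol_rel_add symbol_rel_mult symbol_rel_scaleC symbol_rel_star)

end

section \<open>Generated C*-algebras and the existence of the symbol\<close>

lemma cstar_generated_least:
  "G \<subseteq> S \<Longrightarrow> star_subalgebra S \<Longrightarrow> closed S \<Longrightarrow> cstar_generated G \<subseteq> S"
  unfolding cstar_generated_def by (simp add: hull_minimal)

lemma cstar_generated_superset: "G \<subseteq> cstar_generated G"
  unfolding cstar_generated_def by (rule hull_subset)

lemma cstar_generated_closed_subalgebra:
  "star_subalgebra (cstar_generated G) \<and> closed (cstar_generated G)"
  unfolding cstar_generated_def
  by (rule hull_in) (auto simp: star_subalgebra_def intro!: closed_Inter)

lemma star_hom_on_cstar_generated_unique: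
  fixes f g :: "'a::cstar_algebra \<Rightarrow> 'b::cstar_algebra" and G
  defines "P \<equiv> cstar_generated G"
  assumes "star_hom_on P f" "continuous_on P f" "star_hom_on P g" "continuous_on P g"
    and "\<And>x. x \<in> G \<Longrightarrow> f x = g x" "x \<in> P"
  shows "f x = g x"
proof -
  let ?S = "{x \<in> P. f x = g x}"
  have P: "star_subalgebra P" "closed P"
    using cstar_generated_closed_subalgebra[of G] by (simp_all add: P_def)
  have "closed ?S"
    using assms P by (intro continuous_closed_preimage_constant[of P "\<lambda>x. f x - g x" 0, simplified]
        continuous_on_diff)
  moreover have "star_subalgebra ?S"
  proof -
    have "f 0 = f 0 + f 0" "g 0 = g 0 + g 0"
      using assms(2,4) P(1) unfolding star_hom_on_def star_subalgebra_def by (metis add_0)+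
    then have "f 0 = g 0" by simp
    then show ?thesis
      using assms(2,4) P(1) unfolding star_hom_on_def star_subalgebra_def by auto
  qed
  moreover have "G \<subseteq> ?S" using assms(6) cstar_generated_superset[of G] by (auto simp: P_def)
  ultimately have "P \<subseteq> ?S" unfolding P_def by (intro cstar_generated_least)
  then show ?thesis using assms(7) by blast
qed

lemma tensor_as_indexed_sum:
  obtains n :: nat and x y where "n \<ge> 1" "t = (\<Sum>k=1..n. x k \<otimes> y k)"
proof -
  have "\<exists>n\<ge>1. \<exists>x y. t = (\<Sum>k=1..(n::nat). x k \<otimes> y k)"
  proof (induction t rule: tensor_induct)
    case 1
    \<comment> \<open>The index set may not be empty, so the zero tensor needs one vanishing summand.\<close>
    have "(0::('a, 'b) tensor) = 0 \<otimes> 0" using tensor_add_left[of "0::'a" 0 "0::'b"] by simp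
    then show ?case by (intro exI[of _ 1] conjI exI[of _ "\<lambda>_. 0"]) simp_all
  next
    case (2 a b t)
    then obtain n x y where n: "n \<ge> 1" "t = (\<Sum>k=1..(n::nat). x k \<otimes> y k)" by blast
    have "(\<Sum>k=1..n. (x(Suc n := a)) k \<otimes> (y(Suc n := b)) k) = t"
      unfolding n(2) by (rule sum.cong) auto
    then have "a \<otimes> b + t = (\<Sum>k=1..Suc n. (x(Suc n := a)) k \<otimes> (y(Suc n := b)) k)"
      by (simp add: add.commute)
    then show ?case by (intro exI[of _ "Suc n"] conjI exI) simp
  qed
  then show ?thesis using that by blast
qed

theorem theorem3p3:
  fixes \<pi>1 :: "'a::unital_cstar_algebra \<Rightarrow> 'h::chilbert_space bop"
    and \<pi>2 :: "'b::unital_cstar_algebra \<Rightarrow> 'h bop"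
    and \<iota> :: "('a, 'b) tensor \<Rightarrow> 'c::cstar_algebra"
    and P :: "'h bop set"
  assumes "star_hom \<pi>1" and "star_hom \<pi>2"
    and "P = cstar_generated (range \<pi>1 \<union> range \<pi>2)"
    and "min_tensor_product \<iota>"
    and "\<forall>y y' :: 'b. y * y' = y' * y"
    and "\<forall>a1 a2. compact_op (\<pi>1 a1 * \<pi>2 a2 - \<pi>2 a2 * \<pi>1 a1)"
    and "\<forall>n\<ge>1. \<forall>x y. compact_op (\<Sum>k=1..n. \<pi>1 (x k) * \<pi>2 (y k)) \<longrightarrow>
      (\<Sum>k=1..(n::nat). x k \<otimes> y k) = 0"
  shows "\<exists>!sym. sym \<in> extensional P \<and> star_hom_on P sym \<and> continuous_on P sym \<and>
    (\<forall>x. sym (\<pi>1 x) = \<iota> (x \<otimes> 1)) \<and> (\<forall>y. sym (\<pi>2 y) = \<iota> (1 \<otimes> y))"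
proof -
  interpret ess_commuting_reps \<pi>1 \<pi>2
    by unfold_locales (use assms in auto)
  have "t = 0" if "compact_op (tensor_rep t)" for t
  proof -
    obtain n :: nat and x y where t: "n \<ge> 1" "t = (\<Sum>k=1..n. x k \<otimes> y k)"
      by (rule tensor_as_indexed_sum)
    then show ?thesis using assms(7) that by (simp add: tensor_rep_sum tensor_rep_tensor)
  qed
  then have "cstar_norm (\<lambda>t. ess_norm (tensor_rep t))"
    by (rule cstar_norm_ess_norm_tensor_rep)
  then interpret symbol_setting \<pi>1 \<pi>2 \<iota>
    using assms(4) by unfold_locales (auto simp: min_tensor_product_def minimal_cstar_norm_def)
  let ?D = "{T. \<exists>c. symbol_rel T c}"
  have sym1: "symbol_rel (\<pi>1 x) (\<iota> (x \<otimes> 1))" for x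
    by (intro symbol_rel_tensor rep1_unit_rep)
  have sym2: "symbol_rel (\<pi>2 y) (\<iota> (1 \<otimes> y))" for y
    by (intro symbol_rel_tensor rep2_unit_rep)
  have P: "star_subalgebra P" "range \<pi>1 \<union> range \<pi>2 \<subseteq> P"
    by (simp_all only: assms(3) cstar_generated_closed_subalgebra cstar_generated_superset)
  have "P \<subseteq> ?D"
    unfolding assms(3) using sym1 sym2
    by (intro cstar_generated_least star_subalgebra_symbol_domain closed_symbol_domain) blast
  define sym where "sym = restrict (\<lambda>T. THE c. symbol_rel T c) P"
  have sym_eq: "sym T = c" if "T \<in> P" "symbol_rel T c" for T c
    using that symbol_rel_unique by (auto simp: sym_def)
  have sym: "symbol_rel T (sym T)" if "T \<in> P" for T
    using \<open>P \<subseteq> ?D\<close> that sym_eq by blast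
  have "star_hom_on P sym"
    unfolding star_hom_on_def using P(1)[unfolded star_subalgebra_def]
    by (intro conjI ballI allI sym_eq symbol_rel_add symbol_rel_mult symbol_rel_scaleC
        symbol_rel_star sym) blast+
  moreover have "continuous_on P sym"
  proof (rule lipschitz_on_continuous_on)
    show "(norm unit_rep)-lipschitz_on P sym"
      by (intro lipschitz_onI) (auto simp: dist_norm intro!: symbol_rel_norm_le symbol_rel_diff sym)
  qed
  ultimately have ex: "sym \<in> extensional P \<and> star_hom_on P sym \<and> continuous_on P sym \<and>
    (\<forall>x. sym (\<pi>1 x) = \<iota> (x \<otimes> 1)) \<and> (\<forall>y. sym (\<pi>2 y) = \<iota> (1 \<otimes> y))"
    using P(2) sym1 sym2 sym_eq by (simp add: sym_def image_subset_iff)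
  show ?thesis
  proof (rule ex1I[of _ sym], rule ex)
    fix g
    assume g: "g \<in> extensional P \<and> star_hom_on P g \<and> continuous_on P g \<and>
      (\<forall>x. g (\<pi>1 x) = \<iota> (x \<otimes> 1)) \<and> (\<forall>y. g (\<pi>2 y) = \<iota> (1 \<otimes> y))"
    show "g = sym"
    proof (rule extensionalityI[of _ P])
      fix T assume "T \<in> P"
      have "g S = sym S" if "S \<in> range \<pi>1 \<union> range \<pi>2" for S
        using that g ex by (elim UnE imageE) simp_all
      then show "g T = sym T"
        using star_hom_on_cstar_generated_unique[of "range \<pi>1 \<union> range \<pi>2" g sym T,
            folded assms(3)] g ex \<open>T \<in> P\<close> by blast
    qed (use g ex in blast)+
  qed
qed

end
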